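(* Let $M$ be a finite-dimensional Riemannian manifold, and suppose that $S\subseteq M$ is prox-regular and that its boundary $\partial S$ is a $C^2$ submanifold of $M$. Put $\hat S:=(M\setminus S)\cup\partial S$, which is a closed set. If $x\in\partial S$, then $$T^B_S(x)\cap T^B_{\hat S}(x)=T_x\partial S.$$
   Context: $M$ carries a Riemannian metric $\langle\cdot,\cdot\rangle$ with Riemannian distance $d$; $B(x,r)$ is the open metric ball. A convex set (or neighborhood, or ball) in $M$ means a strongly convex one: any two of its points are joined by a unique minimizing geodesic of $M$, and this geodesic lies in the set; for $x,y$ in a convex neighborhood, $\exp_x^{-1}y$ is the initial velocity of the minimizing geodesic $[0,1]\to M$ from $x$ to $y$. Submanifolds are embedded. Proximal normal cone: for a nonempty closed $S\subseteq M$ and $x\in S$, $\xi\in T_xM$ belongs to $N^P_S(x)$ iff there is $\sigma>0$ such that $\langle\xi,\exp_x^{-1}y\rangle\le\sigma\, d^2(x,y)$ for every $y\in U\cap S$, where $U$ is a convex neighborhood of $x$. Prox-regular: a closed set $S\subseteq M$ is prox-regular at $\bar x\in S$ if there exist $\varepsilon>0$ and $\sigma>0$ such that $B(\bar x,\varepsilon)$ is convex and for every $x\in S\cap B(\bar x,\varepsilon)$ and $v\in N^P_S(x)$ with $\|v\|<\varepsilon$ one has $\langle v,\exp_x^{-1}y\rangle\le\sigma\,d^2(x,y)$ for every $y\in S\cap B(\bar x,\varepsilon)$. $S$ is prox-regular if it is so at each of its points. Bouligand tangent cone of a closed set $A\subseteq M$ at $x\in A$: $T^B_A(x)=\{\lim_{i\to\infty}\frac{\exp_x^{-1}z_i}{t_i}: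 z_i\in U\cap A,\ z_i\to x,\ t_i\downarrow 0\}$, with $U$ a convex neighborhood of $x$. *)

theory Defs
  imports "HOL-Analysis.Analysis"
begin

fun Ck_on :: "nat \<Rightarrow> 'a::real_normed_vector set \<Rightarrow> ('a \<Rightarrow> 'b::real_normed_vector) \<Rightarrow> bool" where
  "Ck_on 0 S f \<longleftrightarrow> continuous_on S f"
| "Ck_on (Suc n) S f \<longleftrightarrow>
     (\<forall>x\<in>S. f differentiable (at x)) \<and> (\<forall>v. Ck_on n S (\<lambda>x. frechet_derivative f (at x) v))"

definition smooth_on :: "'a::real_normed_vector set \<Rightarrow> ('a \<Rightarrow> 'b::real_normed_vector) \<Rightarrow> bool" where
  "smooth_on S f \<longleftrightarrow> (\<forall>n. Ck_on n S f)"


section \<open>Smooth manifolds\<close>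

text \<open>The manifold is the whole type \<open>'m\<close>, modelled on the Euclidean space \<open>'e\<close>.  A chart is a pair
  of its domain and a coordinate map; the values of the map outside the domain are irrelevant.\<close>

type_synonym ('m, 'e) chart = "'m set \<times> ('m \<Rightarrow> 'e)"

definition chart_inv :: "('m, 'e) chart \<Rightarrow> 'e \<Rightarrow> 'm" where
  "chart_inv \<kappa> = inv_into (fst \<kappa>) (snd \<kappa>)"

definition is_chart :: "('m::topological_space, 'e::euclidean_space) chart \<Rightarrow> bool" where
  "is_chart \<kappa> \<longleftrightarrow> open (fst \<kappa>) \<and> open (snd \<kappa> ` fst \<kappa>) \<and>
     homeomorphism (fst \<kappa>) (snd \<kappa> ` fst \<kappa>) (snd \<kappa>) (chart_inv \<kappa>)"

definition transition :: "('m, 'e) chart \<Rightarrow> ('m, 'e) chart \<Rightarrow> 'e \<Rightarrow> 'e" where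
  "transition \<kappa> \<mu> = snd \<mu> \<circ> chart_inv \<kappa>"

definition Ck_compatible ::
  "nat \<Rightarrow> ('m, 'e::euclidean_space) chart \<Rightarrow> ('m, 'e) chart \<Rightarrow> bool" where
  "Ck_compatible n \<kappa> \<mu> \<longleftrightarrow>
     Ck_on n (snd \<kappa> ` (fst \<kappa> \<inter> fst \<mu>)) (transition \<kappa> \<mu>) \<and>
     Ck_on n (snd \<mu> ` (fst \<kappa> \<inter> fst \<mu>)) (transition \<mu> \<kappa>)"

definition smooth_atlas ::
  "('m::{t2_space,second_countable_topology}, 'e::euclidean_space) chart set \<Rightarrow> bool" where
  "smooth_atlas A \<longleftrightarrow> (\<forall>\<kappa>\<in>A. is_chart \<kappa>) \<and> (\<Union>\<kappa>\<in>A. fst \<kappa>) = UNIV \<and>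
     (\<forall>\<kappa>\<in>A. \<forall>\<mu>\<in>A. \<forall>n. Ck_compatible n \<kappa> \<mu>)"


section \<open>Tangent vectors\<close>

text \<open>A tangent vector at \<open>x\<close> is given by its coordinate vectors in all the charts around \<open>x\<close>, which
  transform by the derivatives of the coordinate changes.  The vector space operations are pointwise.
  The entries at charts that do not contain \<open>x\<close> are set to 0 so that equality of tangent vectors is
  equality of functions.\<close>

type_synonym ('m, 'e) tangent = "('m, 'e) chart \<Rightarrow> 'e"

definition tangent_space ::
  "('m, 'e::euclidean_space) chart set \<Rightarrow> 'm \<Rightarrow> ('m, 'e) tangent set" where
  "tangent_space A x = {v.
     (\<forall>\<kappa>\<in>A. \<forall>\<mu>\<in>A. x \<in> fst \<kappa> \<inter> fst \<mu> \<longrightarrow>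
        v \<mu> = frechet_derivative (transition \<kappa> \<mu>) (at (snd \<kappa> x)) (v \<kappa>)) \<and>
     (\<forall>\<kappa>. \<not> (\<kappa> \<in> A \<and> x \<in> fst \<kappa>) \<longrightarrow> v \<kappa> = 0)}"

text \<open>The tangent vector at \<open>x\<close> with coordinates \<open>u\<close> in the chart \<open>\<kappa>\<close>.\<close>

definition coord_vector ::
  "('m, 'e::euclidean_space) chart set \<Rightarrow> ('m, 'e) chart \<Rightarrow> 'm \<Rightarrow> 'e \<Rightarrow> ('m, 'e) tangent" where
  "coord_vector A \<kappa> x u = (\<lambda>\<mu>. if \<mu> \<in> A \<and> x \<in> fst \<mu>
     then frechet_derivative (transition \<kappa> \<mu>) (at (snd \<kappa> x)) u else 0)"

text \<open>Velocity of a curve defined on the interval \<open>I\<close>; it is one-sided at end points in \<open>I\<close>.\<close>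

definition velocity ::
  "('m, 'e::euclidean_space) chart set \<Rightarrow> real set \<Rightarrow> (real \<Rightarrow> 'm) \<Rightarrow> real \<Rightarrow> ('m, 'e) tangent" where
  "velocity A I c t = (\<lambda>\<kappa>. if \<kappa> \<in> A \<and> c t \<in> fst \<kappa>
     then vector_derivative (snd \<kappa> \<circ> c) (at t within I) else 0)"

definition C1_curve ::
  "('m::topological_space, 'e::euclidean_space) chart set \<Rightarrow> real set \<Rightarrow> (real \<Rightarrow> 'm) \<Rightarrow> bool" where
  "C1_curve A I c \<longleftrightarrow> continuous_on I c \<and>
     (\<forall>\<kappa>\<in>A. \<forall>t\<in>I. c t \<in> fst \<kappa> \<longrightarrow>
        (snd \<kappa> \<circ> c) differentiable (at t within I) \<and>
        continuous (at t within I) (\<lambda>s. vector_derivative (snd \<kappa> \<circ> c) (at s within I)))"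

definition piecewise_C1_curve ::
  "('m::topological_space, 'e::euclidean_space) chart set \<Rightarrow> (real \<Rightarrow> 'm) \<Rightarrow> bool" where
  "piecewise_C1_curve A c \<longleftrightarrow> continuous_on {0..1} c \<and>
     (\<exists>F. finite F \<and> (\<forall>a b. 0 \<le> a \<and> a < b \<and> b \<le> 1 \<and> {a<..<b} \<inter> F = {} \<longrightarrow> C1_curve A {a..b} c))"


section \<open>Submanifolds\<close>

text \<open>Embedded submanifolds of class \<open>C\<^sup>n\<close>, by slice charts.  The slice charts are only \<open>C\<^sup>n\<close>-compatible
  with the atlas and need not belong to it.\<close>

definition Ck_submanifold ::
  "nat \<Rightarrow> ('m::topological_space, 'e::euclidean_space) chart set \<Rightarrow> 'm set \<Rightarrow> bool" where
  "Ck_submanifold n A N \<longleftrightarrow> (\<exists>k. \<forall>p\<in>N. \<exists>\<psi> L.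
     is_chart \<psi> \<and> (\<forall>\<kappa>\<in>A. Ck_compatible n \<psi> \<kappa>) \<and> p \<in> fst \<psi> \<and>
     subspace L \<and> dim L = k \<and> snd \<psi> ` (fst \<psi> \<inter> N) = snd \<psi> ` fst \<psi> \<inter> L)"

definition tangent_space_sub ::
  "('m::topological_space, 'e::euclidean_space) chart set \<Rightarrow> 'm set \<Rightarrow> 'm \<Rightarrow> ('m, 'e) tangent set" where
  "tangent_space_sub A N x =
     {velocity A {-\<delta><..<\<delta>} c 0 | c \<delta>.
        \<delta> > 0 \<and> C1_curve A {-\<delta><..<\<delta>} c \<and> c ` {-\<delta><..<\<delta>} \<subseteq> N \<and> c 0 = x}"


section \<open>Riemannian metrics\<close>

type_synonym ('m, 'e) metric = "'m \<Rightarrow> ('m, 'e) tangent \<Rightarrow> ('m, 'e) tangent \<Rightarrow> real"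

definition gram ::
  "('m, 'e::euclidean_space) chart set \<Rightarrow> ('m, 'e) metric \<Rightarrow> ('m, 'e) chart \<Rightarrow>
   'e \<Rightarrow> 'e \<Rightarrow> 'e \<Rightarrow> real" where
  "gram A g \<kappa> u w q = g (chart_inv \<kappa> q)
     (coord_vector A \<kappa> (chart_inv \<kappa> q) u) (coord_vector A \<kappa> (chart_inv \<kappa> q) w)"

definition riemannian_metric ::
  "('m, 'e::euclidean_space) chart set \<Rightarrow> ('m, 'e) metric \<Rightarrow> bool" where
  "riemannian_metric A g \<longleftrightarrow>
     (\<forall>x. \<forall>u\<in>tangent_space A x. \<forall>v\<in>tangent_space A x.
        g x u v = g x v u \<and>
        (u \<noteq> (\<lambda>_. 0) \<longrightarrow> g x u u > 0) \<and>
        (\<forall>w\<in>tangent_space A x. g x (\<lambda>\<kappa>. u \<kappa> + v \<kappa>) w = g x u w + g x v w) \<and>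
        (\<forall>a. g x (\<lambda>\<kappa>. a *\<^sub>R u \<kappa>) v = a * g x u v)) \<and>
     (\<forall>\<kappa>\<in>A. \<forall>u w. smooth_on (snd \<kappa> ` fst \<kappa>) (gram A g \<kappa> u w))"

definition riemannian_manifold ::
  "('m::{t2_space,second_countable_topology}, 'e::euclidean_space) chart set \<Rightarrow>
   ('m, 'e) metric \<Rightarrow> bool" where
  "riemannian_manifold A g \<longleftrightarrow> smooth_atlas A \<and> riemannian_metric A g"

definition tnorm :: "('m, 'e) metric \<Rightarrow> 'm \<Rightarrow> ('m, 'e) tangent \<Rightarrow> real" where
  "tnorm g x v = sqrt (g x v v)"

definition curve_length ::
  "('m, 'e::euclidean_space) chart set \<Rightarrow> ('m, 'e) metric \<Rightarrow> (real \<Rightarrow> 'm) \<Rightarrow> real" where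
  "curve_length A g c = integral {0..1} (\<lambda>t. tnorm g (c t) (velocity A {0..1} c t))"

text \<open>The manifold need not be connected: points in different components are at infinite distance.\<close>

definition riem_edist ::
  "('m::topological_space, 'e::euclidean_space) chart set \<Rightarrow> ('m, 'e) metric \<Rightarrow> 'm \<Rightarrow> 'm \<Rightarrow> ennreal" where
  "riem_edist A g x y =
     (INF c\<in>{c. piecewise_C1_curve A c \<and> c 0 = x \<and> c 1 = y}. ennreal (curve_length A g c))"

definition riem_dist ::
  "('m::topological_space, 'e::euclidean_space) chart set \<Rightarrow> ('m, 'e) metric \<Rightarrow> 'm \<Rightarrow> 'm \<Rightarrow> real" where
  "riem_dist A g x y = enn2real (riem_edist A g x y)"

definition riem_ball ::
  "('m::topological_space, 'e::euclidean_space) chart set \<Rightarrow> ('m, 'e) metric \<Rightarrow> 'm \<Rightarrow> real \<Rightarrow> 'm set" where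
  "riem_ball A g x r = {y. riem_edist A g x y < ennreal r}"


section \<open>Geodesics and convexity\<close>

text \<open>The vector \<open>\<Gamma>\<^sup>k\<^sub>i\<^sub>j u\<^sup>i v\<^sup>j\<close> of the Levi-Civita connection in the chart \<open>\<kappa>\<close>.  It is characterised by
  \<open>\<langle>\<Gamma>(u,v), w\<rangle> = (\<partial>\<^sub>u \<langle>v,w\<rangle> + \<partial>\<^sub>v \<langle>u,w\<rangle> - \<partial>\<^sub>w \<langle>u,v\<rangle>) / 2\<close> for constant coordinate vectors \<open>u\<close>, \<open>v\<close>, \<open>w\<close>.\<close>

definition christoffel ::
  "('m, 'e::euclidean_space) chart set \<Rightarrow> ('m, 'e) metric \<Rightarrow> ('m, 'e) chart \<Rightarrow>
   'e \<Rightarrow> 'e \<Rightarrow> 'e \<Rightarrow> 'e" where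
  "christoffel A g \<kappa> q u v = (THE z. \<forall>w. gram A g \<kappa> z w q =
     (frechet_derivative (gram A g \<kappa> v w) (at q) u +
      frechet_derivative (gram A g \<kappa> u w) (at q) v -
      frechet_derivative (gram A g \<kappa> u v) (at q) w) / 2)"

definition geodesic ::
  "('m::topological_space, 'e::euclidean_space) chart set \<Rightarrow> ('m, 'e) metric \<Rightarrow> (real \<Rightarrow> 'm) \<Rightarrow> bool" where
  "geodesic A g c \<longleftrightarrow> continuous_on {0..1} c \<and>
     (\<forall>\<kappa>\<in>A. \<forall>t\<in>{0..1}. c t \<in> fst \<kappa> \<longrightarrow>
        (let c' = (\<lambda>s. vector_derivative (snd \<kappa> \<circ> c) (at s within {0..1})) in
         (snd \<kappa> \<circ> c) differentiable (at t within {0..1}) \<and>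
         (c' has_vector_derivative - christoffel A g \<kappa> (snd \<kappa> (c t)) (c' t) (c' t))
           (at t within {0..1})))"

definition min_geodesic ::
  "('m::topological_space, 'e::euclidean_space) chart set \<Rightarrow> ('m, 'e) metric \<Rightarrow>
   'm \<Rightarrow> 'm \<Rightarrow> (real \<Rightarrow> 'm) \<Rightarrow> bool" where
  "min_geodesic A g x y c \<longleftrightarrow> geodesic A g c \<and> c 0 = x \<and> c 1 = y \<and>
     ennreal (curve_length A g c) = riem_edist A g x y"

text \<open>Curves are total functions on \<open>real\<close>, so uniqueness is up to equality on the unit interval.\<close>

definition convex_set ::
  "('m::topological_space, 'e::euclidean_space) chart set \<Rightarrow> ('m, 'e) metric \<Rightarrow> 'm set \<Rightarrow> bool" where
  "convex_set A g U \<longleftrightarrow> (\<forall>x\<in>U. \<forall>y\<in>U. \<exists>c. min_geodesic A g x y c \<and> c ` {0..1} \<subseteq> U \<and>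
     (\<forall>c'. min_geodesic A g x y c' \<longrightarrow> (\<forall>t\<in>{0..1}. c' t = c t)))"

definition convex_nbhd ::
  "('m::topological_space, 'e::euclidean_space) chart set \<Rightarrow> ('m, 'e) metric \<Rightarrow> 'm \<Rightarrow> 'm set \<Rightarrow> bool" where
  "convex_nbhd A g x U \<longleftrightarrow> convex_set A g U \<and> x \<in> interior U"

text \<open>Only meaningful if \<open>x\<close> and \<open>y\<close> lie in a common convex set; the initial velocity then does not
  depend on the choice, as all the minimizing geodesics agree on the unit interval.\<close>

definition exp_inv ::
  "('m::topological_space, 'e::euclidean_space) chart set \<Rightarrow> ('m, 'e) metric \<Rightarrow>
   'm \<Rightarrow> 'm \<Rightarrow> ('m, 'e) tangent" where
  "exp_inv A g x y = velocity A {0..1} (SOME c. min_geodesic A g x y c) 0"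


section \<open>Proximal normal cone, prox-regularity, Bouligand tangent cone\<close>

definition prox_normal_cone ::
  "('m::topological_space, 'e::euclidean_space) chart set \<Rightarrow> ('m, 'e) metric \<Rightarrow>
   'm set \<Rightarrow> 'm \<Rightarrow> ('m, 'e) tangent set" where
  "prox_normal_cone A g S x = {\<xi> \<in> tangent_space A x.
     \<exists>U \<sigma>. convex_nbhd A g x U \<and> \<sigma> > 0 \<and>
       (\<forall>y\<in>U \<inter> S. g x \<xi> (exp_inv A g x y) \<le> \<sigma> * (riem_dist A g x y)\<^sup>2)}"

definition prox_regular_at ::
  "('m::topological_space, 'e::euclidean_space) chart set \<Rightarrow> ('m, 'e) metric \<Rightarrow>
   'm set \<Rightarrow> 'm \<Rightarrow> bool" where
  "prox_regular_at A g S z \<longleftrightarrow> (\<exists>\<epsilon>>0. \<exists>\<sigma>>0. convex_set A g (riem_ball A g z \<epsilon>) \<and>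
     (\<forall>x \<in> S \<inter> riem_ball A g z \<epsilon>. \<forall>v \<in> prox_normal_cone A g S x. tnorm g x v < \<epsilon> \<longrightarrow>
        (\<forall>y \<in> S \<inter> riem_ball A g z \<epsilon>. g x v (exp_inv A g x y) \<le> \<sigma> * (riem_dist A g x y)\<^sup>2)))"

definition prox_regular ::
  "('m::topological_space, 'e::euclidean_space) chart set \<Rightarrow> ('m, 'e) metric \<Rightarrow> 'm set \<Rightarrow> bool" where
  "prox_regular A g S \<longleftrightarrow> closed S \<and> (\<forall>z\<in>S. prox_regular_at A g S z)"

text \<open>Convergence in the tangent space is convergence of the coordinates.\<close>

definition bouligand_cone ::
  "('m::topological_space, 'e::euclidean_space) chart set \<Rightarrow> ('m, 'e) metric \<Rightarrow>
   'm set \<Rightarrow> 'm \<Rightarrow> ('m, 'e) tangent set" where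
  "bouligand_cone A g B x = {v \<in> tangent_space A x.
     \<exists>U z t. convex_nbhd A g x U \<and> (\<forall>i::nat. z i \<in> U \<inter> B \<and> t i > 0) \<and>
       z \<longlonglongrightarrow> x \<and> t \<longlonglongrightarrow> (0::real) \<and>
       (\<forall>\<kappa>\<in>A. x \<in> fst \<kappa> \<longrightarrow> (\<lambda>i. exp_inv A g x (z i) \<kappa> /\<^sub>R t i) \<longlonglongrightarrow> v \<kappa>)}"

end

theory Submission
  imports Defs
begin

text \<open>Prox-regularity enters only through the closedness of \<open>S\<close> and the existence of convex
  neighborhoods.  In a chart, a short minimizing geodesic has acceleration bounded by a multiple of
  the square of its speed, so that \<open>exp\<^sub>x\<^sup>-\<^sup>1 y\<close> and the coordinate difference of \<open>y\<close> and \<open>x\<close> agree up to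
  second order; hence Bouligand tangent vectors are limits of coordinate difference quotients.  In a
  slice chart, with the boundary lying in the subspace \<open>L\<close>, a direction \<open>w\<close> outside \<open>L\<close> has a positive
  component along some \<open>n\<close> orthogonal to \<open>L\<close>.  The half ball on the side of \<open>n\<close> is connected and misses
  the boundary, so it lies in \<open>S\<close> or in the complement of \<open>S\<close>, and \<open>w\<close> cannot be tangent to both
  \<open>S\<close> and \<open>Shat\<close>.\<close>

section \<open>Charts and coordinate changes\<close>

text \<open>Geodesics solve their equation in the charts of the atlas, and the slice chart that
  flattens the boundary need not be one of these. The second-order comparison is therefore made in
  an atlas chart \<open>\<kappa>\<close>, by elementary estimates on a single minimizing geodesic. A
  coordinate segment bounds the Riemannian distance from above, so the length of the geodesic is at
  most a multiple of the coordinate distance; being short, it cannot leave a coordinate ball on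
  which metric and Christoffel symbols are bounded. Only the limit of the difference quotients is
  then carried to the slice chart, by the derivative of the coordinate change. The half ball treats
  all dimensions of \<open>L\<close>, and all positions of \<open>S\<close> relative to the
  boundary, alike: \<open>L\<close> lies in the hyperplane orthogonal to \<open>n\<close>, which the
  open half ball avoids whatever the codimension. For the converse inclusion, a curve in the
  boundary lies in both \<open>S\<close> and \<open>Shat\<close>; sampling it at positive times
  tending to 0 exhibits its velocity as an element of both cones.\<close>

lemma Ck_on_Suc_imp: "Ck_on (Suc n) S f \<Longrightarrow> Ck_on n S f"
proof (induction n arbitrary: f)
  case 0
  then show ?case
    by (auto intro!: continuous_at_imp_continuous_on differentiable_imp_continuous_within)
next
  case (Suc n)
  have "\<forall>x\<in>S. f differentiable at x"
    and "Ck_on (Suc n) S (\<lambda>x. frechet_derivative f (at x) v)" for v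
    using Suc.prems unfolding Ck_on.simps(2) [of "Suc n"] by blast+
  then show ?case
    using Suc.IH by (simp only: Ck_on.simps(2)) blast
qed

lemma Ck_compatible_Suc_imp: "Ck_compatible (Suc n) \<kappa> \<mu> \<Longrightarrow> Ck_compatible n \<kappa> \<mu>"
  using Ck_on_Suc_imp unfolding Ck_compatible_def by blast

text \<open>A common notion for atlas charts and slice charts, so that the lemmas on velocities and
  coordinate lines serve both.\<close>

definition C1_coordinates ::
  "('m::topological_space, 'e::euclidean_space) chart set \<Rightarrow> ('m, 'e) chart \<Rightarrow> bool" where
  "C1_coordinates A \<kappa> \<longleftrightarrow> is_chart \<kappa> \<and> (\<forall>\<mu>\<in>A. Ck_compatible 1 \<kappa> \<mu>)"

lemma smooth_atlas_C1_coordinates: "smooth_atlas A \<Longrightarrow> \<kappa> \<in> A \<Longrightarrow> C1_coordinates A \<kappa>"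
  unfolding smooth_atlas_def C1_coordinates_def by blast

lemma Ck_compatible_sym: "Ck_compatible n \<kappa> \<mu> \<Longrightarrow> Ck_compatible n \<mu> \<kappa>"
  unfolding Ck_compatible_def by (simp add: Int_commute)

lemma C1_coordinatesD:
  assumes "C1_coordinates A \<psi>"
  shows "is_chart \<psi>" "\<kappa> \<in> A \<Longrightarrow> Ck_compatible 1 \<psi> \<kappa>" "\<kappa> \<in> A \<Longrightarrow> Ck_compatible 1 \<kappa> \<psi>"
  using assms Ck_compatible_sym unfolding C1_coordinates_def by blast+

lemma smooth_atlas_is_chart: "smooth_atlas A \<Longrightarrow> \<kappa> \<in> A \<Longrightarrow> is_chart \<kappa>"
  unfolding smooth_atlas_def by blast

lemma is_chartD:
  assumes "is_chart \<kappa>"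
  shows "open (fst \<kappa>)" "open (snd \<kappa> ` fst \<kappa>)"
    "homeomorphism (fst \<kappa>) (snd \<kappa> ` fst \<kappa>) (snd \<kappa>) (chart_inv \<kappa>)"
    "continuous_on (fst \<kappa>) (snd \<kappa>)" "continuous_on (snd \<kappa> ` fst \<kappa>) (chart_inv \<kappa>)"
  using assms by (simp_all add: is_chart_def homeomorphism_def)

lemma chart_inv_chart [simp]: "is_chart \<kappa> \<Longrightarrow> x \<in> fst \<kappa> \<Longrightarrow> chart_inv \<kappa> (snd \<kappa> x) = x"
  unfolding is_chart_def homeomorphism_def by blast

lemma chart_chart_inv [simp]:
  "is_chart \<kappa> \<Longrightarrow> q \<in> snd \<kappa> ` fst \<kappa> \<Longrightarrow> snd \<kappa> (chart_inv \<kappa> q) = q"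
  unfolding is_chart_def homeomorphism_def by blast

lemma chart_inv_in [simp]: "is_chart \<kappa> \<Longrightarrow> q \<in> snd \<kappa> ` fst \<kappa> \<Longrightarrow> chart_inv \<kappa> q \<in> fst \<kappa>"
  by (metis chart_inv_def inv_into_into)

lemma open_chart_image:
  assumes "is_chart \<kappa>" "open W"
  shows "open (snd \<kappa> ` (fst \<kappa> \<inter> W))"
proof -
  note h = is_chartD(3) [OF assms(1)] and o = is_chartD(1,2) [OF assms(1)]
  have "openin (top_of_set (fst \<kappa>)) (fst \<kappa> \<inter> W)"
    using assms(2) by (simp add: openin_open_Int)
  then have "openin (top_of_set (snd \<kappa> ` fst \<kappa>)) (snd \<kappa> ` (fst \<kappa> \<inter> W))"
    using homeomorphism_imp_open_map [OF h] by blast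
  then show ?thesis
    using o(2) openin_open_trans by blast
qed

lemma tendsto_chart:
  assumes ch: "is_chart \<kappa>" and x: "x \<in> fst \<kappa>" and z: "(z \<longlongrightarrow> x) F"
  shows "((\<lambda>i. snd \<kappa> (z i)) \<longlongrightarrow> snd \<kappa> x) F"
  by (rule continuous_on_tendsto_compose
      [OF is_chartD(4) [OF ch] z x topological_tendstoD [OF z is_chartD(1) [OF ch] x]])

lemma tendsto_chart_inv:
  assumes ch: "is_chart \<kappa>" and q: "q \<in> snd \<kappa> ` fst \<kappa>" and z: "(z \<longlongrightarrow> q) F"
  shows "((\<lambda>i. chart_inv \<kappa> (z i)) \<longlongrightarrow> chart_inv \<kappa> q) F"
  by (rule continuous_on_tendsto_compose
      [OF is_chartD(5) [OF ch] z q topological_tendstoD [OF z is_chartD(2) [OF ch] q]])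

lemma transition_has_derivative:
  assumes "Ck_compatible 1 \<kappa> \<mu>" "x \<in> fst \<kappa>" "x \<in> fst \<mu>"
  shows "(transition \<kappa> \<mu> has_derivative frechet_derivative (transition \<kappa> \<mu>) (at (snd \<kappa> x)))
    (at (snd \<kappa> x))"
proof -
  have "transition \<kappa> \<mu> differentiable at (snd \<kappa> x)"
    using assms unfolding Ck_compatible_def by auto
  then show ?thesis
    by (simp add: frechet_derivative_works)
qed

lemma linear_transition_derivative:
  assumes "Ck_compatible 1 \<kappa> \<mu>" "x \<in> fst \<kappa>" "x \<in> fst \<mu>"
  shows "linear (frechet_derivative (transition \<kappa> \<mu>) (at (snd \<kappa> x)))"
  using transition_has_derivative [OF assms] has_derivative_linear by blast

lemma transition_derivative_self:
  assumes "is_chart \<kappa>" "x \<in> fst \<kappa>"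
  shows "frechet_derivative (transition \<kappa> \<kappa>) (at (snd \<kappa> x)) u = u"
proof -
  have o: "open (snd \<kappa> ` fst \<kappa>)"
    using assms(1) is_chartD(2) by blast
  have "(transition \<kappa> \<kappa> has_derivative (\<lambda>u. u)) (at (snd \<kappa> x))"
    by (rule has_derivative_transform_within_open [OF has_derivative_ident o])
       (use assms in \<open>auto simp: transition_def\<close>)
  then show ?thesis
    by (simp add: frechet_derivative_at [symmetric])
qed

text \<open>Cocycle rule, by the chain rule. The composite coincides with the direct coordinate
  change only on the image of the overlap of \<open>\<kappa>\<close> and \<open>\<mu>\<close>, an
  open set around the point.\<close>

lemma transition_derivative_comp:
  assumes ch: "is_chart \<kappa>" "is_chart \<mu>" "is_chart \<nu>"
    and c: "Ck_compatible 1 \<kappa> \<mu>" "Ck_compatible 1 \<mu> \<nu>"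
    and x: "x \<in> fst \<kappa>" "x \<in> fst \<mu>" "x \<in> fst \<nu>"
  shows "frechet_derivative (transition \<mu> \<nu>) (at (snd \<mu> x))
      (frechet_derivative (transition \<kappa> \<mu>) (at (snd \<kappa> x)) u)
    = frechet_derivative (transition \<kappa> \<nu>) (at (snd \<kappa> x)) u"
proof -
  have e: "transition \<kappa> \<mu> (snd \<kappa> x) = snd \<mu> x"
    using ch x by (simp add: transition_def)
  have d: "(transition \<mu> \<nu> \<circ> transition \<kappa> \<mu> has_derivative
      frechet_derivative (transition \<mu> \<nu>) (at (snd \<mu> x)) \<circ>
      frechet_derivative (transition \<kappa> \<mu>) (at (snd \<kappa> x))) (at (snd \<kappa> x))"
    by (rule diff_chain_at)
       (use transition_has_derivative [OF c(1) x(1,2)] transition_has_derivative [OF c(2) x(2,3)] e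
        in auto)
  have "open (snd \<kappa> ` (fst \<kappa> \<inter> fst \<mu>))"
    using open_chart_image ch is_chartD(1) by blast
  then have "(transition \<kappa> \<nu> has_derivative
      frechet_derivative (transition \<mu> \<nu>) (at (snd \<mu> x)) \<circ>
      frechet_derivative (transition \<kappa> \<mu>) (at (snd \<kappa> x))) (at (snd \<kappa> x))"
    by (rule has_derivative_transform_within_open [OF d])
       (use ch x in \<open>auto simp: transition_def\<close>)
  then show ?thesis
    by (simp add: frechet_derivative_at [symmetric])
qed

lemma coord_vector_apply:
  "\<mu> \<in> A \<Longrightarrow> x \<in> fst \<mu> \<Longrightarrow>
    coord_vector A \<kappa> x u \<mu> = frechet_derivative (transition \<kappa> \<mu>) (at (snd \<kappa> x)) u"
  by (simp add: coord_vector_def)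

lemma coord_vector_outside: "\<not> (\<mu> \<in> A \<and> x \<in> fst \<mu>) \<Longrightarrow> coord_vector A \<kappa> x u \<mu> = 0"
  by (simp only: coord_vector_def if_False)

lemma coord_vector_self:
  assumes "is_chart \<kappa>" "\<kappa> \<in> A" "x \<in> fst \<kappa>"
  shows "coord_vector A \<kappa> x u \<kappa> = u"
  using assms by (simp add: coord_vector_apply transition_derivative_self)

lemma coord_vector_in_tangent_space:
  assumes A: "smooth_atlas A" and \<psi>: "C1_coordinates A \<psi>" "x \<in> fst \<psi>"
  shows "coord_vector A \<psi> x u \<in> tangent_space A x"
  unfolding tangent_space_def mem_Collect_eq
proof (intro conjI ballI impI allI)
  fix \<kappa> \<mu> assume \<kappa>: "\<kappa> \<in> A" "\<mu> \<in> A" "x \<in> fst \<kappa> \<inter> fst \<mu>"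
  have "frechet_derivative (transition \<kappa> \<mu>) (at (snd \<kappa> x))
      (frechet_derivative (transition \<psi> \<kappa>) (at (snd \<psi> x)) u)
    = frechet_derivative (transition \<psi> \<mu>) (at (snd \<psi> x)) u"
    by (rule transition_derivative_comp)
       (use \<kappa> \<psi>(2) A smooth_atlas_is_chart [OF A] C1_coordinatesD [OF \<psi>(1)]
         in \<open>simp_all add: smooth_atlas_def\<close>)
  then show "coord_vector A \<psi> x u \<mu>
      = frechet_derivative (transition \<kappa> \<mu>) (at (snd \<kappa> x)) (coord_vector A \<psi> x u \<kappa>)"
    using \<kappa> by (simp add: coord_vector_apply)
qed (rule coord_vector_outside)

lemma tangent_eq_coord_vector:
  assumes v: "v \<in> tangent_space A x" and \<kappa>: "\<kappa> \<in> A" "x \<in> fst \<kappa>"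
  shows "v = coord_vector A \<kappa> x (v \<kappa>)"
proof
  fix \<mu>
  show "v \<mu> = coord_vector A \<kappa> x (v \<kappa>) \<mu>"
  proof (cases "\<mu> \<in> A \<and> x \<in> fst \<mu>")
    case True
    then have "v \<mu> = frechet_derivative (transition \<kappa> \<mu>) (at (snd \<kappa> x)) (v \<kappa>)"
      using v \<kappa> unfolding tangent_space_def by blast
    then show ?thesis
      using True by (simp add: coord_vector_apply)
  next
    case False
    then have "v \<mu> = 0"
      using v unfolding tangent_space_def by blast
    then show ?thesis
      using coord_vector_outside [OF False] by simp
  qed
qed

text \<open>Since \<open>\<psi>\<close> need not belong to the atlas, a tangent vector has no \<open>\<psi>\<close>-entry; its coordinates
  in \<open>\<psi>\<close> are obtained from those in \<open>\<kappa>\<close>.\<close>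

lemma coord_vector_change:
  assumes A: "smooth_atlas A" and \<psi>: "C1_coordinates A \<psi>" "x \<in> fst \<psi>"
    and v: "v \<in> tangent_space A x" and \<kappa>: "\<kappa> \<in> A" "x \<in> fst \<kappa>"
  shows "v = coord_vector A \<psi> x (frechet_derivative (transition \<kappa> \<psi>) (at (snd \<kappa> x)) (v \<kappa>))"
    (is "v = coord_vector A \<psi> x ?w")
proof -
  note ch = smooth_atlas_is_chart [OF A \<kappa>(1)] C1_coordinatesD [OF \<psi>(1)]
  have "coord_vector A \<psi> x ?w \<kappa> = v \<kappa>"
    using transition_derivative_comp [OF ch(1,2,1) ch(4,3) [OF \<kappa>(1)] \<kappa>(2) \<psi>(2) \<kappa>(2)]
    by (simp add: coord_vector_apply [OF \<kappa>] transition_derivative_self [OF ch(1) \<kappa>(2)])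
  then show ?thesis
    using tangent_eq_coord_vector [OF coord_vector_in_tangent_space [OF A \<psi>] \<kappa>, of ?w]
      tangent_eq_coord_vector [OF v \<kappa>] by simp
qed

lemma linear_coord_vector:
  assumes A: "smooth_atlas A" and \<psi>: "C1_coordinates A \<psi>" "x \<in> fst \<psi>"
  shows "coord_vector A \<psi> x (u + w) = (\<lambda>\<kappa>. coord_vector A \<psi> x u \<kappa> + coord_vector A \<psi> x w \<kappa>)"
    and "coord_vector A \<psi> x (a *\<^sub>R u) = (\<lambda>\<kappa>. a *\<^sub>R coord_vector A \<psi> x u \<kappa>)"
proof -
  have "linear (frechet_derivative (transition \<psi> \<mu>) (at (snd \<psi> x)))"
    if "\<mu> \<in> A" "x \<in> fst \<mu>" for \<mu>
    by (rule linear_transition_derivative [OF C1_coordinatesD(2) [OF \<psi>(1) that(1)] \<psi>(2) that(2)])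
  then show "coord_vector A \<psi> x (u + w) = (\<lambda>\<kappa>. coord_vector A \<psi> x u \<kappa> + coord_vector A \<psi> x w \<kappa>)"
    and "coord_vector A \<psi> x (a *\<^sub>R u) = (\<lambda>\<kappa>. a *\<^sub>R coord_vector A \<psi> x u \<kappa>)"
    by (auto simp: coord_vector_def fun_eq_iff linear_add linear_scale)
qed

section \<open>Velocities\<close>

lemma curve_change_chart:
  assumes ch: "is_chart \<psi>" "is_chart \<mu>" "Ck_compatible 1 \<psi> \<mu>"
    and c: "continuous (at t within I) c" and t: "c t \<in> fst \<psi>" "c t \<in> fst \<mu>" "t \<in> I"
    and d: "(snd \<psi> \<circ> c has_vector_derivative d) (at t within I)"
  shows "(snd \<mu> \<circ> c has_vector_derivative
      frechet_derivative (transition \<psi> \<mu>) (at (snd \<psi> (c t))) d) (at t within I)"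
proof -
  have D: "(transition \<psi> \<mu> has_derivative frechet_derivative (transition \<psi> \<mu>) (at (snd \<psi> (c t))))
      (at ((snd \<psi> \<circ> c) t))"
    using transition_has_derivative [OF ch(3)] t by simp
  have "(transition \<psi> \<mu> \<circ> (snd \<psi> \<circ> c) has_derivative
      frechet_derivative (transition \<psi> \<mu>) (at (snd \<psi> (c t))) \<circ> (\<lambda>h. h *\<^sub>R d)) (at t within I)"
    by (rule diff_chain_within)
       (use d D in \<open>auto simp: has_vector_derivative_def intro: has_derivative_at_withinI\<close>)
  then have "(transition \<psi> \<mu> \<circ> (snd \<psi> \<circ> c) has_vector_derivative
      frechet_derivative (transition \<psi> \<mu>) (at (snd \<psi> (c t))) d) (at t within I)"
    using D by (simp add: has_vector_derivative_def o_def linear_scale has_derivative_linear)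
  \<comment> \<open>Outside the domain of \<open>\<psi>\<close> the map
    \<open>chart_inv \<psi>\<close> does not recover the point; continuity of \<open>c\<close> keeps
    nearby points inside, so the chain rule gives the derivative of
    \<open>snd \<mu> \<circ> c\<close>.\<close>
  moreover have "\<forall>\<^sub>F s in at t within I. c s \<in> fst \<psi>"
    by (rule topological_tendstoD [OF c [unfolded continuous_within] is_chartD(1) [OF ch(1)] t(1)])
  then have "\<forall>\<^sub>F s in at t within I. (transition \<psi> \<mu> \<circ> (snd \<psi> \<circ> c)) s = (snd \<mu> \<circ> c) s"
    by eventually_elim (use ch in \<open>simp add: transition_def\<close>)
  moreover have "(transition \<psi> \<mu> \<circ> (snd \<psi> \<circ> c)) t = (snd \<mu> \<circ> c) t"
    using ch t by (simp add: transition_def)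
  ultimately show ?thesis
    using t(3) has_derivative_transform_eventually [of "transition \<psi> \<mu> \<circ> (snd \<psi> \<circ> c)" _ t I "snd \<mu> \<circ> c"]
    by (simp add: has_vector_derivative_def)
qed

text \<open>A derivative in one chart, possibly outside the atlas, determines all entries of the
  velocity. Nontriviality of the filter makes derivatives unique, so that
  \<open>vector_derivative\<close> returns the one obtained by the chain rule.\<close>

lemma velocity_eq_coord_vector:
  assumes A: "smooth_atlas A" and \<psi>: "C1_coordinates A \<psi>"
    and c: "continuous (at t within I) c" and t: "c t \<in> fst \<psi>" "t \<in> I" "at t within I \<noteq> bot"
    and d: "(snd \<psi> \<circ> c has_vector_derivative d) (at t within I)"
  shows "velocity A I c t = coord_vector A \<psi> (c t) d"
proof
  fix \<mu>
  show "velocity A I c t \<mu> = coord_vector A \<psi> (c t) d \<mu>"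
  proof (cases "\<mu> \<in> A \<and> c t \<in> fst \<mu>")
    case True
    have "(snd \<mu> \<circ> c has_vector_derivative
        frechet_derivative (transition \<psi> \<mu>) (at (snd \<psi> (c t))) d) (at t within I)"
      by (rule curve_change_chart [OF _ _ _ c t(1) _ t(2) d])
         (use True smooth_atlas_is_chart [OF A] C1_coordinatesD [OF \<psi>] in simp_all)
    then show ?thesis
      using True t(3) by (simp add: velocity_def coord_vector_def vector_derivative_within)
  qed (auto simp: velocity_def coord_vector_def)
qed


section \<open>The metric in coordinates\<close>

text \<open>Separates the vectors from the form: for a form depending on a point, the dependence
  sits in the finitely many numbers \<open>h a b\<close>, and regularity in the point can be read
  off from them.\<close>

lemma bilinear_expand:
  fixes h :: "'e::euclidean_space \<Rightarrow> 'e \<Rightarrow> real"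
  assumes "bilinear h"
  shows "h u w = (\<Sum>a\<in>Basis. \<Sum>b\<in>Basis. (u \<bullet> a) * (w \<bullet> b) * h a b)"
proof -
  have l: "linear (\<lambda>x. h x y)" "linear (h y)" for y
    using assms unfolding bilinear_def by auto
  have "h u w = h (\<Sum>a\<in>Basis. (u \<bullet> a) *\<^sub>R a) w"
    by (simp add: euclidean_representation)
  also have "\<dots> = (\<Sum>a\<in>Basis. (u \<bullet> a) * h a w)"
    using linear_sum [OF l(1), of "\<lambda>a. (u \<bullet> a) *\<^sub>R a" Basis w] linear_scale [OF l(1)] by simp
  also have "\<dots> = (\<Sum>a\<in>Basis. (u \<bullet> a) * (\<Sum>b\<in>Basis. (w \<bullet> b) * h a b))"
  proof (rule sum.cong [OF refl])
    fix a :: 'e assume "a \<in> Basis"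
    have "h a w = h a (\<Sum>b\<in>Basis. (w \<bullet> b) *\<^sub>R b)"
      by (simp add: euclidean_representation)
    also have "\<dots> = (\<Sum>b\<in>Basis. (w \<bullet> b) * h a b)"
      using linear_sum [OF l(2), of a "\<lambda>b. (w \<bullet> b) *\<^sub>R b" Basis] linear_scale [OF l(2)] by simp
    finally show "(u \<bullet> a) * h a w = (u \<bullet> a) * (\<Sum>b\<in>Basis. (w \<bullet> b) * h a b)"
      by simp
  qed
  finally show ?thesis
    by (simp add: sum_distrib_left mult.assoc)
qed

text \<open>Riesz representation for an inner product other than the standard one. The map
  \<open>T\<close> is injective because \<open>T z = 0\<close> forces \<open>h z z = 0\<close>,
  hence surjective by finite dimension. Existence together with uniqueness is what the definite
  description in \<open>christoffel\<close> requires.\<close>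

lemma bilinear_posdef_represents:
  fixes h :: "'e::euclidean_space \<Rightarrow> 'e \<Rightarrow> real"
  assumes h: "bilinear h" "\<And>u. u \<noteq> 0 \<Longrightarrow> h u u > 0" and R: "linear R"
  shows "\<exists>!z. \<forall>w. h z w = R w"
proof (rule ex_ex1I)
  have l: "linear (\<lambda>x. h x y)" "linear (h y)" for y
    using h(1) unfolding bilinear_def by auto
  define T where "T z = (\<Sum>b\<in>Basis. h z b *\<^sub>R b)" for z
  have T: "T z \<bullet> b = h z b" if "b \<in> Basis" for z b
    using that by (simp add: T_def)
  have "linear T"
    by (rule linearI)
       (simp_all add: T_def linear_add [OF l(1)] linear_scale [OF l(1)] scaleR_add_left
         sum.distrib scaleR_sum_right)
  moreover have "inj T"
    unfolding linear_injective_0 [OF \<open>linear T\<close>]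
  proof (intro allI impI)
    fix z assume z: "T z = 0"
    have "h z b = 0" if "b \<in> Basis" for b
      using T [OF that, of z] z by simp
    then have "h z (\<Sum>b\<in>Basis. (z \<bullet> b) *\<^sub>R b) = 0"
      by (simp add: linear_sum [OF l(2)] linear_scale [OF l(2)])
    then have "h z z = 0"
      by (simp add: euclidean_representation)
    then show "z = 0"
      using h(2) [of z] by fastforce
  qed
  ultimately have "surj T"
    by (rule linear_inj_imp_surj)
  then obtain z where z: "T z = (\<Sum>b\<in>Basis. R b *\<^sub>R b)"
    by (metis surjD)
  have "h z b = R b" if "b \<in> Basis" for b
    using T [OF that, of z] that by (simp add: z)
  then have "h z = R"
    using linear_eq_stdbasis [OF l(2) R] by blast
  then show "\<exists>z. \<forall>w. h z w = R w"
    by auto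
next
  fix z z' assume z: "\<forall>w. h z w = R w" "\<forall>w. h z' w = R w"
  have "linear (\<lambda>x. h x (z - z'))"
    using h(1) unfolding bilinear_def by auto
  then have "h (z - z') (z - z') = h z (z - z') - h z' (z - z')"
    by (rule linear_diff)
  then show "z = z'"
    using z h(2) [of "z - z'"] by (cases "z = z'") auto
qed

text \<open>Each coordinate of a vector is at most its norm, and the triple sum has
  \<open>DIM('e) ^ 3\<close> terms. The form of the sum is that of
  \<open>gram_derivative_expand\<close>.\<close>

lemma trilinear_sum_bound:
  fixes u v w :: "'e::euclidean_space"
  assumes "\<And>a b c. a \<in> Basis \<Longrightarrow> b \<in> Basis \<Longrightarrow> c \<in> Basis \<Longrightarrow> \<bar>f a b c\<bar> \<le> B"
  shows "\<bar>\<Sum>a\<in>Basis. \<Sum>b\<in>Basis. (v \<bullet> a) * (w \<bullet> b) * (\<Sum>c\<in>Basis. (u \<bullet> c) * f a b c)\<bar>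
    \<le> real DIM('e) ^ 3 * B * norm u * norm v * norm w"
proof -
  have c: "\<bar>\<Sum>c\<in>Basis. (u \<bullet> c) * f a b c\<bar> \<le> real DIM('e) * (norm u * B)"
    if ab: "a \<in> Basis" "b \<in> Basis" for a b
  proof -
    have "\<bar>\<Sum>c\<in>Basis. (u \<bullet> c) * f a b c\<bar> \<le> (\<Sum>c\<in>(Basis::'e set). norm u * B)"
      by (rule order_trans [OF sum_abs], rule sum_mono)
         (use ab assms in \<open>auto simp: abs_mult intro!: mult_mono Basis_le_norm\<close>)
    then show ?thesis by simp
  qed
  have b: "\<bar>\<Sum>b\<in>Basis. (v \<bullet> a) * (w \<bullet> b) * (\<Sum>c\<in>Basis. (u \<bullet> c) * f a b c)\<bar>
      \<le> real DIM('e) * (norm v * norm w * (real DIM('e) * (norm u * B)))"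
    if a: "a \<in> Basis" for a
  proof -
    have "\<bar>\<Sum>b\<in>Basis. (v \<bullet> a) * (w \<bullet> b) * (\<Sum>c\<in>Basis. (u \<bullet> c) * f a b c)\<bar>
      \<le> (\<Sum>b\<in>(Basis::'e set). norm v * norm w * (real DIM('e) * (norm u * B)))"
    proof (rule order_trans [OF sum_abs], rule sum_mono)
      fix b :: 'e assume b: "b \<in> Basis"
      show "\<bar>(v \<bullet> a) * (w \<bullet> b) * (\<Sum>c\<in>Basis. (u \<bullet> c) * f a b c)\<bar>
        \<le> norm v * norm w * (real DIM('e) * (norm u * B))"
        unfolding abs_mult [of "(v \<bullet> a) * (w \<bullet> b)"] abs_mult [of "v \<bullet> a"]
        by (intro mult_mono c a b Basis_le_norm mult_nonneg_nonneg abs_ge_zero norm_ge_zero)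
    qed
    then show ?thesis by simp
  qed
  have "\<bar>\<Sum>a\<in>Basis. \<Sum>b\<in>Basis. (v \<bullet> a) * (w \<bullet> b) * (\<Sum>c\<in>Basis. (u \<bullet> c) * f a b c)\<bar>
    \<le> (\<Sum>a\<in>(Basis::'e set). real DIM('e) * (norm v * norm w * (real DIM('e) * (norm u * B))))"
    by (rule order_trans [OF sum_abs], rule sum_mono) (rule b)
  then show ?thesis
    by (simp add: power3_eq_cube mult_ac)
qed

section \<open>Metric coefficients and Christoffel symbols over compact coordinate sets\<close>

locale riemannian =
  fixes A :: "('m::{t2_space,second_countable_topology}, 'e::euclidean_space) chart set"
    and g :: "('m, 'e) metric"
  assumes riemannian: "riemannian_manifold A g"
begin

lemma atlas: "smooth_atlas A"
  using riemannian unfolding riemannian_manifold_def by blast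

lemma atlas_coordinates: "\<kappa> \<in> A \<Longrightarrow> C1_coordinates A \<kappa>"
  by (rule smooth_atlas_C1_coordinates [OF atlas])

lemma atlas_chart: "\<kappa> \<in> A \<Longrightarrow> is_chart \<kappa>"
  by (rule smooth_atlas_is_chart [OF atlas])

lemma gram_bilinear:
  assumes \<kappa>: "\<kappa> \<in> A" and q: "q \<in> snd \<kappa> ` fst \<kappa>"
  shows "bilinear (\<lambda>u w. gram A g \<kappa> u w q)"
    and "gram A g \<kappa> u w q = gram A g \<kappa> w u q"
    and "u \<noteq> 0 \<Longrightarrow> gram A g \<kappa> u u q > 0"
proof -
  define x where "x = chart_inv \<kappa> q"
  have x: "x \<in> fst \<kappa>"
    using chart_inv_in [OF atlas_chart [OF \<kappa>] q] by (simp add: x_def)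
  have t: "coord_vector A \<kappa> x u \<in> tangent_space A x" for u
    by (rule coord_vector_in_tangent_space [OF atlas atlas_coordinates [OF \<kappa>] x])
  have m: "\<forall>u\<in>tangent_space A x. \<forall>v\<in>tangent_space A x.
        g x u v = g x v u \<and>
        (u \<noteq> (\<lambda>_. 0) \<longrightarrow> g x u u > 0) \<and>
        (\<forall>w\<in>tangent_space A x. g x (\<lambda>\<kappa>. u \<kappa> + v \<kappa>) w = g x u w + g x v w) \<and>
        (\<forall>a. g x (\<lambda>\<kappa>. a *\<^sub>R u \<kappa>) v = a * g x u v)"
    using riemannian unfolding riemannian_manifold_def riemannian_metric_def by blast
  have s: "gram A g \<kappa> u w q = gram A g \<kappa> w u q" for u w
    unfolding gram_def x_def [symmetric] using m t by blast
  have add: "gram A g \<kappa> (u + v) w q = gram A g \<kappa> u w q + gram A g \<kappa> v w q" for u v w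
    unfolding gram_def x_def [symmetric] linear_coord_vector(1) [OF atlas atlas_coordinates [OF \<kappa>] x]
    using m t by blast
  have scale: "gram A g \<kappa> (a *\<^sub>R u) w q = a * gram A g \<kappa> u w q" for a u w
    unfolding gram_def x_def [symmetric] linear_coord_vector(2) [OF atlas atlas_coordinates [OF \<kappa>] x]
    using m t by blast
  show "gram A g \<kappa> u w q = gram A g \<kappa> w u q"
    by (rule s)
  show "bilinear (\<lambda>u w. gram A g \<kappa> u w q)"
    unfolding bilinear_def
  proof (intro conjI allI)
    \<comment> \<open>The axioms of the metric give linearity in the first argument; symmetry
      transfers it to the second.\<close>
    show "linear (\<lambda>w. gram A g \<kappa> u w q)" for u
      unfolding s [of u] by (rule linearI) (simp_all add: add scale)
    show "linear (\<lambda>u. gram A g \<kappa> u w q)" for w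
      by (rule linearI) (simp_all add: add scale)
  qed
  show "gram A g \<kappa> u u q > 0" if "u \<noteq> 0"
  proof -
    have "coord_vector A \<kappa> x u \<kappa> = u"
      by (rule coord_vector_self [OF atlas_chart [OF \<kappa>] \<kappa> x])
    then have "coord_vector A \<kappa> x u \<noteq> (\<lambda>_. 0)"
      using that by auto
    then show ?thesis
      unfolding gram_def x_def [symmetric] using m t by blast
  qed
qed

lemmas gram_expand = bilinear_expand [OF gram_bilinear(1)]

lemma gram_Ck: "\<kappa> \<in> A \<Longrightarrow> Ck_on n (snd \<kappa> ` fst \<kappa>) (gram A g \<kappa> u w)"
  using riemannian unfolding riemannian_manifold_def riemannian_metric_def smooth_on_def by blast

lemma gram_differentiable:
  "\<kappa> \<in> A \<Longrightarrow> q \<in> snd \<kappa> ` fst \<kappa> \<Longrightarrow> gram A g \<kappa> u w differentiable at q"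
  using gram_Ck [of \<kappa> "Suc 0" u w] by auto

lemma gram_continuous: "\<kappa> \<in> A \<Longrightarrow> continuous_on (snd \<kappa> ` fst \<kappa>) (gram A g \<kappa> u w)"
  using gram_Ck [of \<kappa> 0 u w] by simp

lemma gram_derivative_continuous:
  "\<kappa> \<in> A \<Longrightarrow> continuous_on (snd \<kappa> ` fst \<kappa>) (\<lambda>q. frechet_derivative (gram A g \<kappa> u w) (at q) v)"
  using gram_Ck [of \<kappa> "Suc 0" u w] by simp

text \<open>Smoothness of the metric concerns fixed coordinate vectors; the basis expansion upgrades
  it to joint continuity when vectors and point vary together.\<close>

lemma gram_continuous_on:
  assumes \<kappa>: "\<kappa> \<in> A" and f: "continuous_on T f" and h: "continuous_on T h"
    and sub: "h ` T \<subseteq> snd \<kappa> ` fst \<kappa>"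
  shows "continuous_on T (\<lambda>t. gram A g \<kappa> (f t) (f t) (h t))"
proof -
  have "continuous_on T (\<lambda>t. \<Sum>a\<in>Basis. \<Sum>b\<in>Basis. (f t \<bullet> a) * (f t \<bullet> b) * gram A g \<kappa> a b (h t))"
    by (intro continuous_intros f continuous_on_compose2 [OF gram_continuous [OF \<kappa>] h sub])
  then show ?thesis
    by (rule continuous_on_eq) (use gram_expand [OF \<kappa>] sub in \<open>simp add: image_subset_iff\<close>)
qed

text \<open>The quadratic form is continuous and positive on the compact product of the unit sphere
  with \<open>K\<close>, so it has a positive minimum and a finite maximum there; homogeneity
  extends both bounds to all vectors.\<close>

lemma gram_bounds:
  assumes \<kappa>: "\<kappa> \<in> A" and K: "compact K" "K \<subseteq> snd \<kappa> ` fst \<kappa>"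
  obtains m M where "m > 0" "M > 0"
    "\<And>q u. q \<in> K \<Longrightarrow> m * (norm u)\<^sup>2 \<le> gram A g \<kappa> u u q"
    "\<And>q u. q \<in> K \<Longrightarrow> gram A g \<kappa> u u q \<le> M * (norm u)\<^sup>2"
proof (cases "K = {}")
  case True
  then show ?thesis
    using that [of 1 1] by auto
next
  case False
  let ?S = "sphere (0::'e) 1 \<times> K"
  let ?F = "\<lambda>p. gram A g \<kappa> (fst p) (fst p) (snd p)"
  have c: "continuous_on ?S ?F"
    by (rule gram_continuous_on [OF \<kappa>]) (use K in \<open>auto intro!: continuous_intros\<close>)
  obtain b :: 'e where "b \<in> Basis"
    using nonempty_Basis by blast
  then have ne: "?S \<noteq> {}"
    using False by (auto intro!: exI [of _ b])
  have cp: "compact ?S"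
    using K(1) by (intro compact_Times compact_sphere)
  obtain p where p: "p \<in> ?S" "\<And>s. s \<in> ?S \<Longrightarrow> ?F p \<le> ?F s"
    using continuous_attains_inf [OF cp ne c] by blast
  obtain p' where p': "p' \<in> ?S" "\<And>s. s \<in> ?S \<Longrightarrow> ?F s \<le> ?F p'"
    using continuous_attains_sup [OF cp ne c] by blast
  have pos: "?F s > 0" if "s \<in> ?S" for s
    by (rule gram_bilinear(3) [OF \<kappa>]) (use that K in auto)
  have sc: "gram A g \<kappa> u u q = (norm u)\<^sup>2 * ?F (u /\<^sub>R norm u, q)" if "u \<noteq> 0" "q \<in> K" for u q
  proof -
    have bl: "bilinear (\<lambda>u w. gram A g \<kappa> u w q)"
      using gram_bilinear(1) [OF \<kappa>] that K by blast
    have "gram A g \<kappa> (norm u *\<^sub>R (u /\<^sub>R norm u)) (norm u *\<^sub>R (u /\<^sub>R norm u)) q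
        = (norm u)\<^sup>2 * ?F (u /\<^sub>R norm u, q)"
      by (simp add: bilinear_lmul [OF bl] bilinear_rmul [OF bl] power2_eq_square del: scaleR_scaleR)
    then show ?thesis
      using that by simp
  qed
  have "?F p * (norm u)\<^sup>2 \<le> gram A g \<kappa> u u q \<and> gram A g \<kappa> u u q \<le> ?F p' * (norm u)\<^sup>2"
    if q: "q \<in> K" for u q
  proof (cases "u = 0")
    case True
    have "gram A g \<kappa> 0 0 q = 0"
      using bilinear_lzero [OF gram_bilinear(1) [OF \<kappa>]] q K by blast
    then show ?thesis
      using True by simp
  next
    case False
    then have "(u /\<^sub>R norm u, q) \<in> ?S"
      using q by simp
    then show ?thesis
      unfolding sc [OF False q] using p(2) [of "(u /\<^sub>R norm u, q)"] p'(2) [of "(u /\<^sub>R norm u, q)"]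
      by (simp only: mult.commute [of _ "(norm u)\<^sup>2"] mult_left_mono zero_le_power2)
  qed
  then show ?thesis
    using that [of "?F p" "?F p'"] pos p(1) p'(1) by blast
qed

text \<open>Differentiate the basis expansion in the point, with constant coefficients, and expand
  each derivative in its direction \<open>u\<close> by linearity.\<close>

lemma gram_derivative_expand:
  assumes \<kappa>: "\<kappa> \<in> A" and q: "q \<in> snd \<kappa> ` fst \<kappa>"
  shows "frechet_derivative (gram A g \<kappa> v w) (at q) u
    = (\<Sum>a\<in>Basis. \<Sum>b\<in>Basis. (v \<bullet> a) * (w \<bullet> b) *
        (\<Sum>c\<in>Basis. (u \<bullet> c) * frechet_derivative (gram A g \<kappa> a b) (at q) c))"
proof -
  have d: "(gram A g \<kappa> a b has_derivative frechet_derivative (gram A g \<kappa> a b) (at q)) (at q)" for a b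
    using gram_differentiable [OF \<kappa> q] by (simp add: frechet_derivative_works)
  have "((\<lambda>q. \<Sum>a\<in>Basis. \<Sum>b\<in>Basis. (v \<bullet> a) * (w \<bullet> b) * gram A g \<kappa> a b q) has_derivative
      (\<lambda>u. \<Sum>a\<in>Basis. \<Sum>b\<in>Basis. (v \<bullet> a) * (w \<bullet> b) * frechet_derivative (gram A g \<kappa> a b) (at q) u))
      (at q)"
    by (intro has_derivative_sum has_derivative_mult_right d)
  then have "(gram A g \<kappa> v w has_derivative
      (\<lambda>u. \<Sum>a\<in>Basis. \<Sum>b\<in>Basis. (v \<bullet> a) * (w \<bullet> b) * frechet_derivative (gram A g \<kappa> a b) (at q) u))
      (at q)"
    by (rule has_derivative_transform_within_open [OF _ is_chartD(2) [OF atlas_chart [OF \<kappa>]] q])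
       (rule gram_expand [OF \<kappa>, symmetric])
  then have e: "frechet_derivative (gram A g \<kappa> v w) (at q) =
      (\<lambda>u. \<Sum>a\<in>Basis. \<Sum>b\<in>Basis. (v \<bullet> a) * (w \<bullet> b) * frechet_derivative (gram A g \<kappa> a b) (at q) u)"
    by (rule frechet_derivative_at [symmetric])
  have c: "frechet_derivative (gram A g \<kappa> a b) (at q) u
      = (\<Sum>c\<in>Basis. (u \<bullet> c) * frechet_derivative (gram A g \<kappa> a b) (at q) c)" for a b
  proof -
    have l: "linear (frechet_derivative (gram A g \<kappa> a b) (at q))"
      using d has_derivative_linear by blast
    show ?thesis
      using linear_sum [OF l, of "\<lambda>c. (u \<bullet> c) *\<^sub>R c" Basis] linear_scale [OF l]
      by (simp add: euclidean_representation)
  qed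
  show ?thesis
    unfolding e by (intro sum.cong refl arg_cong2 [where f = "(*)"] c)
qed

lemma gram_derivative_bound:
  assumes \<kappa>: "\<kappa> \<in> A" and K: "compact K" "K \<subseteq> snd \<kappa> ` fst \<kappa>"
  obtains B where "B \<ge> 0" "\<And>q u v w. q \<in> K \<Longrightarrow>
    \<bar>frechet_derivative (gram A g \<kappa> v w) (at q) u\<bar> \<le> B * norm u * norm v * norm w"
proof -
  let ?d = "\<lambda>q a b c. frechet_derivative (gram A g \<kappa> a b) (at q) c"
  have "\<exists>C. \<forall>q\<in>K. \<bar>?d q a b c\<bar> \<le> C" for a b c
  proof -
    have "compact ((\<lambda>q. ?d q a b c) ` K)"
      using continuous_on_subset [OF gram_derivative_continuous [OF \<kappa>] K(2)] K(1)
      by (rule compact_continuous_image)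
    then show ?thesis
      by (auto dest!: compact_imp_bounded simp: bounded_iff)
  qed
  then obtain C where C: "\<And>a b c q. q \<in> K \<Longrightarrow> \<bar>?d q a b c\<bar> \<le> C a b c"
    by metis
  \<comment> \<open>The sum of the absolute values dominates every single constant and takes the
    place of a maximum over index triples.\<close>
  define B where "B = (\<Sum>a\<in>(Basis::'e set). \<Sum>b\<in>(Basis::'e set). \<Sum>c\<in>(Basis::'e set). \<bar>C a b c\<bar>)"
  have B: "\<bar>C a b c\<bar> \<le> B" if "a \<in> Basis" "b \<in> Basis" "c \<in> Basis" for a b c
  proof -
    have "\<bar>C a b c\<bar> \<le> (\<Sum>c\<in>Basis. \<bar>C a b c\<bar>)"
      using that by (intro member_le_sum) auto
    also have "\<dots> \<le> (\<Sum>b\<in>Basis. \<Sum>c\<in>Basis. \<bar>C a b c\<bar>)"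
      using that by (intro member_le_sum [where f = "\<lambda>b. \<Sum>c\<in>Basis. \<bar>C a b c\<bar>"]) (auto intro: sum_nonneg)
    also have "\<dots> \<le> B"
      unfolding B_def using that
      by (intro member_le_sum [where f = "\<lambda>a. \<Sum>b\<in>Basis. \<Sum>c\<in>Basis. \<bar>C a b c\<bar>"])
         (auto intro!: sum_nonneg)
    finally show ?thesis .
  qed
  have B0: "B \<ge> 0"
    unfolding B_def by (intro sum_nonneg) auto
  show ?thesis
  proof (rule that [of "real DIM('e) ^ 3 * B"])
    show "real DIM('e) ^ 3 * B \<ge> 0"
      using B0 by simp
    fix q u v w assume q: "q \<in> K"
    show "\<bar>frechet_derivative (gram A g \<kappa> v w) (at q) u\<bar>
        \<le> real DIM('e) ^ 3 * B * norm u * norm v * norm w"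
      unfolding gram_derivative_expand [OF \<kappa> subsetD [OF K(2) q], of v w u]
    proof (rule trilinear_sum_bound)
      fix a b c :: 'e assume "a \<in> Basis" "b \<in> Basis" "c \<in> Basis"
      then show "\<bar>?d q a b c\<bar> \<le> B"
        using B [of a b c] C [OF q, of a b c] by linarith
    qed
  qed
qed

text \<open>Linearity in \<open>w\<close> is not a property of one derivative, since the
  differentiated function changes with \<open>w\<close>; it is visible in the expansion. Linearity
  in the direction \<open>u\<close> is that of the derivative itself.\<close>

lemma linear_gram_derivative:
  assumes \<kappa>: "\<kappa> \<in> A" and q: "q \<in> snd \<kappa> ` fst \<kappa>"
  shows "linear (\<lambda>w. frechet_derivative (gram A g \<kappa> v w) (at q) u)"
    and "linear (\<lambda>u. frechet_derivative (gram A g \<kappa> v w) (at q) u)"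
proof -
  have lin: "linear (\<lambda>w. \<Sum>a\<in>Basis. \<Sum>b\<in>Basis. (v \<bullet> a) * (w \<bullet> b) * X a b)" for X :: "'e \<Rightarrow> 'e \<Rightarrow> real"
    by (intro bounded_linear.linear bounded_linear_sum bounded_linear_mult_const
        bounded_linear_const_mult bounded_linear_inner_left)
  have "(\<lambda>w. frechet_derivative (gram A g \<kappa> v w) (at q) u)
    = (\<lambda>w. \<Sum>a\<in>Basis. \<Sum>b\<in>Basis. (v \<bullet> a) * (w \<bullet> b) *
        (\<Sum>c\<in>Basis. (u \<bullet> c) * frechet_derivative (gram A g \<kappa> a b) (at q) c))"
    by (rule ext) (rule gram_derivative_expand [OF \<kappa> q])
  then show "linear (\<lambda>w. frechet_derivative (gram A g \<kappa> v w) (at q) u)"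
    by (simp only: lin)
  have "(gram A g \<kappa> v w has_derivative frechet_derivative (gram A g \<kappa> v w) (at q)) (at q)"
    using gram_differentiable [OF \<kappa> q] by (simp add: frechet_derivative_works)
  then show "linear (\<lambda>u. frechet_derivative (gram A g \<kappa> v w) (at q) u)"
    by (rule has_derivative_linear)
qed

text \<open>Test the defining identity of the Christoffel vector \<open>z\<close> with
  \<open>w = z\<close>: the left side is at least \<open>m * (norm z)\<^sup>2\<close>, the right
  side is linear in \<open>norm z\<close>, and one factor cancels.\<close>

lemma christoffel_bound:
  assumes \<kappa>: "\<kappa> \<in> A" and K: "compact K" "K \<subseteq> snd \<kappa> ` fst \<kappa>"
  obtains B where "B \<ge> 0" "\<And>q u v. q \<in> K \<Longrightarrow>
    norm (christoffel A g \<kappa> q u v) \<le> B * norm u * norm v"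
proof -
  obtain m M where m: "m > 0" "M > 0"
    "\<And>q u. q \<in> K \<Longrightarrow> m * (norm u)\<^sup>2 \<le> gram A g \<kappa> u u q"
    "\<And>q u. q \<in> K \<Longrightarrow> gram A g \<kappa> u u q \<le> M * (norm u)\<^sup>2"
    using gram_bounds [OF \<kappa> K] by blast
  obtain B where B: "B \<ge> 0" "\<And>q u v w. q \<in> K \<Longrightarrow>
    \<bar>frechet_derivative (gram A g \<kappa> v w) (at q) u\<bar> \<le> B * norm u * norm v * norm w"
    using gram_derivative_bound [OF \<kappa> K] by blast
  show ?thesis
  proof (rule that [of "2 * B / m"])
    show "2 * B / m \<ge> 0"
      using B(1) m(1) by simp
    fix q u v assume q: "q \<in> K"
    then have qD: "q \<in> snd \<kappa> ` fst \<kappa>"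
      using K by blast
    let ?R = "\<lambda>w. (frechet_derivative (gram A g \<kappa> v w) (at q) u +
      frechet_derivative (gram A g \<kappa> u w) (at q) v -
      frechet_derivative (gram A g \<kappa> u v) (at q) w) / 2"
    have "linear (\<lambda>w. (1/2) *\<^sub>R (frechet_derivative (gram A g \<kappa> v w) (at q) u +
      frechet_derivative (gram A g \<kappa> u w) (at q) v -
      frechet_derivative (gram A g \<kappa> u v) (at q) w))"
      by (intro linear_compose_scale_right linear_compose_sub linear_compose_add
          linear_gram_derivative [OF \<kappa> qD])
    then have R: "linear ?R"
      by (simp only: real_scaleR_def mult.commute [of "1/2"] times_divide_eq_right mult_1_right)
    have "\<exists>!z. \<forall>w. gram A g \<kappa> z w q = ?R w"
      by (rule bilinear_posdef_represents [OF gram_bilinear(1) [OF \<kappa> qD] _ R])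
         (rule gram_bilinear(3) [OF \<kappa> qD])
    from theI' [OF this] have z: "gram A g \<kappa> (christoffel A g \<kappa> q u v) w q = ?R w" for w
      unfolding christoffel_def by blast
    let ?z = "christoffel A g \<kappa> q u v"
    have "m * (norm ?z)\<^sup>2 \<le> ?R ?z"
      unfolding z [of ?z, symmetric] by (rule m(3) [OF q])
    also have "\<dots> \<le> 2 * B * norm u * norm v * norm ?z"
    proof -
      define X where "X = B * norm u * norm v * norm ?z"
      have "0 \<le> X"
        using B(1) by (simp add: X_def)
      moreover have "\<bar>frechet_derivative (gram A g \<kappa> v ?z) (at q) u\<bar> \<le> X"
        using B(2) [OF q, of v ?z u] by (simp add: X_def)
      moreover have "\<bar>frechet_derivative (gram A g \<kappa> u ?z) (at q) v\<bar> \<le> X"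
        using B(2) [OF q, of u ?z v] by (simp add: X_def mult_ac)
      moreover have "\<bar>frechet_derivative (gram A g \<kappa> u v) (at q) ?z\<bar> \<le> X"
        using B(2) [OF q, of u v ?z] by (simp add: X_def mult_ac)
      \<comment> \<open>Three terms of size at most \<open>X\<close>, halved, give 3/2 times
        \<open>X\<close>, rounded up to the constant 2.\<close>
      moreover have "(a + b - c) / 2 \<le> 2 * X"
        if "0 \<le> X" "\<bar>a\<bar> \<le> X" "\<bar>b\<bar> \<le> X" "\<bar>c\<bar> \<le> X" for a b c :: real
        using that by (simp add: field_simps abs_le_iff)
      ultimately have "?R ?z \<le> 2 * X"
        by blast
      then show ?thesis
        by (simp add: X_def)
    qed
    finally have "m * norm ?z * norm ?z \<le> (2 * B * norm u * norm v) * norm ?z"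
      by (simp add: power2_eq_square)
    then have "m * norm ?z \<le> 2 * B * norm u * norm v"
      using B(1) by (cases "norm ?z = 0") (auto simp: mult_le_cancel_right)
    then show "norm ?z \<le> 2 * B / m * norm u * norm v"
      using m(1) by (simp add: field_simps)
  qed
qed

end


section \<open>Short curves of quadratically bounded acceleration\<close>

text \<open>A mean value inequality against the antiderivative of a continuous majorant, so that
  \<open>f'\<close> itself need not be integrated. It is applied to positions and to
  velocities.\<close>

lemma norm_diff_le_integral:
  fixes f :: "real \<Rightarrow> 'a::real_normed_vector"
  assumes ab: "a \<le> b"
    and f: "\<And>t. t \<in> {a..b} \<Longrightarrow> (f has_vector_derivative f' t) (at t within {a..b})"
    and \<phi>: "continuous_on {a..b} \<phi>" "\<And>t. t \<in> {a..b} \<Longrightarrow> norm (f' t) \<le> \<phi> t"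
  shows "norm (f b - f a) \<le> integral {a..b} \<phi>"
proof (cases "a = b")
  case True
  then show ?thesis by simp
next
  case False
  then have "a < b"
    using ab by simp
  have "norm (f b - f a) \<le> integral {a..b} \<phi> - integral {a..a} \<phi>"
  proof (rule differentiable_bound_general [OF \<open>a < b\<close>, where f' = f' and \<phi>' = \<phi>])
    show "continuous_on {a..b} f"
      unfolding continuous_on_eq_continuous_within
      using f has_vector_derivative_continuous by blast
    show "continuous_on {a..b} (\<lambda>u. integral {a..u} \<phi>)"
      by (intro indefinite_integral_continuous_1 integrable_continuous_real \<phi>)
    fix t assume t: "a < t" "t < b"
    then show "(f has_vector_derivative f' t) (at t)" "norm (f' t) \<le> \<phi> t"
      using f [of t] \<phi>(2) [of t] at_within_Icc_at [OF t] by simp_all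
    show "((\<lambda>u. integral {a..u} \<phi>) has_vector_derivative \<phi> t) (at t)"
      using integral_has_vector_derivative [OF \<phi>(1), of t] at_within_Icc_at [OF t] t by simp
  qed
  then show ?thesis by simp
qed

text \<open>The bound on the acceleration and the bound on the length make the speed almost constant; it is
  then comparable to the length.\<close>

lemma short_curve_almost_straight:
  fixes \<gamma> \<gamma>' \<gamma>'' :: "real \<Rightarrow> 'a::euclidean_space"
  assumes \<gamma>: "\<And>t. t \<in> {0..1} \<Longrightarrow> (\<gamma> has_vector_derivative \<gamma>' t) (at t within {0..1})"
    and \<gamma>': "\<And>t. t \<in> {0..1} \<Longrightarrow> (\<gamma>' has_vector_derivative \<gamma>'' t) (at t within {0..1})"
    and \<gamma>'': "\<And>t. t \<in> {0..1} \<Longrightarrow> norm (\<gamma>'' t) \<le> B * (norm (\<gamma>' t))\<^sup>2"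
    and \<delta>: "integral {0..1} (\<lambda>t. norm (\<gamma>' t)) \<le> \<delta>" and B: "B \<ge> 0" "B * \<delta> \<le> 1 / 2"
  shows "norm (\<gamma>' 0 - (\<gamma> 1 - \<gamma> 0)) \<le> 2 * B * \<delta>\<^sup>2"
proof -
  define v where "v t = norm (\<gamma>' t)" for t
  have "continuous_on {0..1} \<gamma>'"
    unfolding continuous_on_eq_continuous_within
    using \<gamma>' has_vector_derivative_continuous by blast
  then have cl: "continuous_on {0..1} v"
    unfolding v_def by (rule continuous_on_norm)
  obtain t1 where t1: "t1 \<in> {0..1}" "\<And>t. t \<in> {0..1} \<Longrightarrow> v t \<le> v t1"
    using continuous_attains_sup [OF compact_Icc _ cl] by auto
  obtain t2 where t2: "t2 \<in> {0..1}" "\<And>t. t \<in> {0..1} \<Longrightarrow> v t2 \<le> v t"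
    using continuous_attains_inf [OF compact_Icc _ cl] by auto
  define M where "M = v t1"
  have l0: "v t \<ge> 0" for t
    by (simp add: v_def)
  have \<delta>': "integral {0..1} v \<le> \<delta>"
    using \<delta> by (simp add: v_def [abs_def])
  have M0: "M \<ge> 0"
    using l0 by (simp add: M_def)
  have mono: "norm (\<gamma>' b - \<gamma>' a) \<le> B * M * \<delta>" if ab: "0 \<le> a" "a \<le> b" "b \<le> 1" for a b
  proof -
    have sub: "{a..b} \<subseteq> {0..1}"
      using ab by auto
    have "norm (\<gamma>' b - \<gamma>' a) \<le> integral {a..b} (\<lambda>t. B * M * v t)"
    proof (rule norm_diff_le_integral [OF ab(2)])
      fix t assume "t \<in> {a..b}"
      then have t: "t \<in> {0..1}"
        using sub by blast
      show "(\<gamma>' has_vector_derivative \<gamma>'' t) (at t within {a..b})"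
        by (rule has_vector_derivative_within_subset [OF \<gamma>' [OF t] sub])
      have "norm (\<gamma>'' t) \<le> B * (v t * v t)"
        using \<gamma>'' [OF t] by (simp add: v_def power2_eq_square)
      \<comment> \<open>Only one factor of the squared speed is replaced by the maximum
        \<open>M\<close>; the other one integrates to the length, which is at most
        \<open>\<delta>\<close>.\<close>
      also have "\<dots> \<le> B * (M * v t)"
        using t1(2) [OF t] l0 [of t] B(1) by (intro mult_left_mono mult_right_mono) (auto simp: M_def)
      finally show "norm (\<gamma>'' t) \<le> B * M * v t"
        by (simp add: mult.assoc)
    qed (intro continuous_intros continuous_on_subset [OF cl sub])
    also have "\<dots> = B * M * integral {a..b} v"
      by simp
    also have "integral {a..b} v \<le> integral {0..1} v"
      by (intro integral_subset_le integrable_continuous_real continuous_on_subset [OF cl] sub)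
         (use l0 in auto)
    then have "B * M * integral {a..b} v \<le> B * M * \<delta>"
      using \<delta>' B(1) M0 by (intro mult_left_mono) auto
    finally show ?thesis .
  qed
  have dist: "norm (\<gamma>' b - \<gamma>' a) \<le> B * M * \<delta>" if "a \<in> {0..1}" "b \<in> {0..1}" for a b
    using mono [of a b] mono [of b a] that by (cases "a \<le> b") (auto simp: norm_minus_commute)
  \<comment> \<open>Maximal and minimal speed differ by at most \<open>B * \<delta> * M\<close>,
    which is at most \<open>M / 2\<close>, so the maximum is at most twice the minimum. The minimum
    is at most the length, whence \<open>M \<le> 2 * \<delta>\<close>.\<close>
  have "M \<le> v t2 + B * \<delta> * M"
    using dist [OF t2(1) t1(1)] norm_triangle_ineq2 [of "\<gamma>' t1" "\<gamma>' t2"]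
    by (simp add: M_def v_def mult_ac)
  also have "B * \<delta> * M \<le> 1 / 2 * M"
    by (rule mult_right_mono [OF B(2) M0])
  finally have "M \<le> 2 * v t2"
    by simp
  moreover have "integral {0..1} (\<lambda>t::real. v t2) \<le> integral {0..1} v"
    by (rule Henstock_Kurzweil_Integration.integral_le) (use t2 cl in \<open>auto intro: integrable_continuous_real\<close>)
  ultimately have M: "M \<le> 2 * \<delta>"
    using \<delta>' by simp
  \<comment> \<open>Subtracting the uniform motion with velocity \<open>\<gamma>' 0\<close> leaves a
    curve whose derivative \<open>\<gamma>' t - \<gamma>' 0\<close> has just been estimated.\<close>
  have "norm ((\<gamma> 1 - 1 *\<^sub>R \<gamma>' 0) - (\<gamma> 0 - 0 *\<^sub>R \<gamma>' 0)) \<le> integral {0..1} (\<lambda>t::real. B * M * \<delta>)"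
  proof (rule norm_diff_le_integral)
    fix t :: real assume t: "t \<in> {0..1}"
    show "((\<lambda>t. \<gamma> t - t *\<^sub>R \<gamma>' 0) has_vector_derivative \<gamma>' t - \<gamma>' 0) (at t within {0..1})"
      by (auto intro!: derivative_eq_intros \<gamma> [OF t])
    show "norm (\<gamma>' t - \<gamma>' 0) \<le> B * M * \<delta>"
      by (rule dist) (use t in auto)
  qed auto
  then have "norm (\<gamma>' 0 - (\<gamma> 1 - \<gamma> 0)) \<le> B * M * \<delta>"
    by (simp add: norm_minus_commute algebra_simps)
  also have "\<delta> \<ge> 0"
    using M M0 by simp
  then have "B * M * \<delta> \<le> B * (2 * \<delta>) * \<delta>"
    using M B(1) by (intro mult_right_mono mult_left_mono) auto
  finally show ?thesis
    by (simp add: power2_eq_square mult_ac)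
qed

section \<open>Geodesics in coordinates\<close>

lemma at_within_unit_interval_neq_bot: "t \<in> {0..1} \<Longrightarrow> at t within {0..1::real} \<noteq> bot"
  by (simp add: trivial_limit_within)

context riemannian
begin

lemma atlas_cover: obtains \<kappa> where "\<kappa> \<in> A" "x \<in> fst \<kappa>"
  using atlas unfolding smooth_atlas_def by blast

lemma gram_nonneg:
  assumes "\<kappa> \<in> A" "q \<in> snd \<kappa> ` fst \<kappa>"
  shows "gram A g \<kappa> u u q \<ge> 0"
  using gram_bilinear(3) [OF assms, of u] bilinear_lzero [OF gram_bilinear(1) [OF assms], of u]
  by (cases "u = 0") (auto intro: less_imp_le)

lemma speed_in_chart:
  assumes \<kappa>: "\<kappa> \<in> A" "c t \<in> fst \<kappa>" and t: "t \<in> I" "at t within I \<noteq> bot"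
    and c: "continuous (at t within I) c"
    and d: "(snd \<kappa> \<circ> c has_vector_derivative d) (at t within I)"
  shows "tnorm g (c t) (velocity A I c t) = sqrt (gram A g \<kappa> d d (snd \<kappa> (c t)))"
proof -
  have "velocity A I c t = coord_vector A \<kappa> (c t) d"
    by (rule velocity_eq_coord_vector [OF atlas atlas_coordinates [OF \<kappa>(1)] c \<kappa>(2) t d])
  then show ?thesis
    using chart_inv_chart [OF atlas_chart [OF \<kappa>(1)] \<kappa>(2)] by (simp add: tnorm_def gram_def)
qed

context
  fixes c :: "real \<Rightarrow> 'm"
  assumes c: "geodesic A g c"
begin

abbreviation (input) coord_velocity :: "('m, 'e) chart \<Rightarrow> real \<Rightarrow> 'e" where
  "coord_velocity \<kappa> t \<equiv> vector_derivative (snd \<kappa> \<circ> c) (at t within {0..1})"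

abbreviation (input) speed :: "real \<Rightarrow> real" where
  "speed t \<equiv> tnorm g (c t) (velocity A {0..1} c t)"

lemma geodesic_derivatives:
  assumes "\<kappa> \<in> A" "t \<in> {0..1}" "c t \<in> fst \<kappa>"
  shows "(snd \<kappa> \<circ> c has_vector_derivative coord_velocity \<kappa> t) (at t within {0..1})"
    and "(coord_velocity \<kappa> has_vector_derivative
      - christoffel A g \<kappa> (snd \<kappa> (c t)) (coord_velocity \<kappa> t) (coord_velocity \<kappa> t))
      (at t within {0..1})"
  using c assms unfolding geodesic_def Let_def vector_derivative_works by blast+

lemma geodesic_continuous: "continuous_on {0..1} c"
  using c unfolding geodesic_def by blast

lemma geodesic_speed:
  assumes "\<kappa> \<in> A" "t \<in> {0..1}" "c t \<in> fst \<kappa>"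
  shows "speed t = sqrt (gram A g \<kappa> (coord_velocity \<kappa> t) (coord_velocity \<kappa> t) (snd \<kappa> (c t)))"
proof (rule speed_in_chart [of \<kappa> c t "{0..1}", OF assms(1,3,2) at_within_unit_interval_neq_bot [OF assms(2)]])
  show "continuous (at t within {0..1}) c"
    using geodesic_continuous assms(2) by (simp add: continuous_on_eq_continuous_within)
qed (rule geodesic_derivatives [OF assms])

text \<open>In HOL the square root of a negative number is negative, so this rests on positivity of
  the metric, used in some chart around the point.\<close>

lemma geodesic_speed_nonneg:
  assumes "t \<in> {0..1}"
  shows "speed t \<ge> 0"
proof -
  obtain \<kappa> where \<kappa>: "\<kappa> \<in> A" "c t \<in> fst \<kappa>"
    by (rule atlas_cover)
  show ?thesis
    unfolding geodesic_speed [OF \<kappa>(1) assms \<kappa>(2)]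
    by (intro real_sqrt_ge_zero gram_nonneg [OF \<kappa>(1)] imageI \<kappa>(2))
qed

lemma geodesic_speed_continuous: "continuous_on {0..1} speed"
  unfolding continuous_on_eq_continuous_within
proof
  fix t :: real assume t: "t \<in> {0..1}"
  obtain \<kappa> where \<kappa>: "\<kappa> \<in> A" "c t \<in> fst \<kappa>"
    by (rule atlas_cover)
  \<comment> \<open>Continuity is local: on the relatively open set of times spent in one chart the
    speed has a coordinate formula, and limits within that set at \<open>t\<close> are limits within
    the unit interval.\<close>
  obtain V where V: "open V" "V \<inter> {0..1} = c -` fst \<kappa> \<inter> {0..1}"
    using continuous_on_open_invariant [THEN iffD1, OF geodesic_continuous, rule_format,
        OF is_chartD(1) [OF atlas_chart [OF \<kappa>(1)]]] by blast
  define T where "T = V \<inter> {0..1}"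
  have T: "s \<in> {0..1}" "c s \<in> fst \<kappa>" if "s \<in> T" for s
    using that V(2) unfolding T_def by blast+
  have "continuous_on T (\<lambda>s. sqrt (gram A g \<kappa> (coord_velocity \<kappa> s) (coord_velocity \<kappa> s)
      ((snd \<kappa> \<circ> c) s)))"
  proof (intro continuous_on_real_sqrt gram_continuous_on [OF \<kappa>(1)])
    have sub: "T \<subseteq> {0..1}"
      by (simp add: T_def)
    have "continuous (at s within T) (coord_velocity \<kappa>)" "continuous (at s within T) (snd \<kappa> \<circ> c)"
      if "s \<in> T" for s
      using has_vector_derivative_continuous [OF geodesic_derivatives(1) [OF \<kappa>(1) T [OF that]]]
        has_vector_derivative_continuous [OF geodesic_derivatives(2) [OF \<kappa>(1) T [OF that]]]
      by (simp_all only: continuous_within_subset [OF _ sub])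
    then show "continuous_on T (coord_velocity \<kappa>)" "continuous_on T (snd \<kappa> \<circ> c)"
      unfolding continuous_on_eq_continuous_within by blast+
    show "(snd \<kappa> \<circ> c) ` T \<subseteq> snd \<kappa> ` fst \<kappa>"
      using T by auto
  qed
  then have "continuous_on T speed"
    by (rule continuous_on_eq) (simp add: geodesic_speed [OF \<kappa>(1) T] o_def)
  moreover have tT: "t \<in> V" "t \<in> T"
    using t \<kappa>(2) V(2) unfolding T_def by blast+
  ultimately have "continuous (at t within T) speed"
    by (simp only: continuous_on_eq_continuous_within)
  moreover have "at t within T = at t within {0..1}"
    by (rule at_within_nhd [OF tT(1) V(1)]) (auto simp: T_def)
  ultimately show "continuous (at t within {0..1}) speed"
    by (simp only:)
qed

lemma coord_speed_le:
  assumes \<kappa>: "\<kappa> \<in> A" and t: "t \<in> {0..1}" "c t \<in> fst \<kappa>"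
    and m: "m > 0" "\<And>u. m * (norm u)\<^sup>2 \<le> gram A g \<kappa> u u (snd \<kappa> (c t))"
  shows "sqrt m * norm (coord_velocity \<kappa> t) \<le> speed t"
proof -
  have "sqrt m * norm (coord_velocity \<kappa> t) = sqrt (m * (norm (coord_velocity \<kappa> t))\<^sup>2)"
    by (simp add: real_sqrt_mult)
  also have "\<dots> \<le> speed t"
    unfolding geodesic_speed [OF \<kappa> t] by (rule real_sqrt_le_mono [OF m(2)])
  finally show ?thesis .
qed

text \<open>Only the part of the curve up to time \<open>s\<close> has to lie in the chart, so the
  estimate can be used before the whole curve is known to stay there. Nonnegative speed bounds the
  partial length by the full one.\<close>

lemma geodesic_displacement:
  assumes \<kappa>: "\<kappa> \<in> A" and s: "0 \<le> s" "s \<le> 1"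
    and in_K: "\<And>t. t \<in> {0..s} \<Longrightarrow> c t \<in> fst \<kappa>" "\<And>t. t \<in> {0..s} \<Longrightarrow> snd \<kappa> (c t) \<in> K"
    and m: "m > 0" "\<And>q u. q \<in> K \<Longrightarrow> m * (norm u)\<^sup>2 \<le> gram A g \<kappa> u u q"
  shows "sqrt m * norm (snd \<kappa> (c s) - snd \<kappa> (c 0)) \<le> curve_length A g c"
proof -
  have sub: "{0..s} \<subseteq> {0..1}"
    using s by auto
  have "norm (sqrt m *\<^sub>R (snd \<kappa> \<circ> c) s - sqrt m *\<^sub>R (snd \<kappa> \<circ> c) 0) \<le> integral {0..s} speed"
  proof (rule norm_diff_le_integral [OF s(1)])
    fix t assume ts: "t \<in> {0..s}"
    then have t: "t \<in> {0..1}"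
      using sub by blast
    show "((\<lambda>t. sqrt m *\<^sub>R (snd \<kappa> \<circ> c) t) has_vector_derivative sqrt m *\<^sub>R coord_velocity \<kappa> t)
        (at t within {0..s})"
      by (intro has_vector_derivative_within_subset [OF _ sub]
          bounded_linear.has_vector_derivative [OF bounded_linear_scaleR_right]
          geodesic_derivatives(1) [OF \<kappa> t in_K(1) [OF ts]])
    show "norm (sqrt m *\<^sub>R coord_velocity \<kappa> t) \<le> speed t"
      using coord_speed_le [OF \<kappa> t in_K(1) [OF ts] m(1) m(2) [OF in_K(2) [OF ts]]] m(1) by simp
  qed (rule continuous_on_subset [OF geodesic_speed_continuous sub])
  also have "\<dots> \<le> integral {0..1} speed"
    using geodesic_speed_nonneg
    by (intro integral_subset_le sub integrable_continuous_real
        continuous_on_subset [OF geodesic_speed_continuous sub] geodesic_speed_continuous) auto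
  finally show ?thesis
    using m(1) by (simp add: curve_length_def flip: scaleR_diff_right)
qed

text \<open>First exit argument. Before the first exit from the open ball of radius
  \<open>r\<close>, the displacement estimate keeps the curve within radius \<open>r / 2\<close>; by
  continuity the exit point is still there, a contradiction.\<close>

lemma geodesic_stays_in_ball:
  assumes \<kappa>: "\<kappa> \<in> A" "c 0 \<in> fst \<kappa>" and r: "r > 0" "cball (snd \<kappa> (c 0)) r \<subseteq> snd \<kappa> ` fst \<kappa>"
    and m: "m > 0" "\<And>q u. q \<in> cball (snd \<kappa> (c 0)) r \<Longrightarrow> m * (norm u)\<^sup>2 \<le> gram A g \<kappa> u u q"
    and len: "curve_length A g c < sqrt m * (r / 2)" and t: "t \<in> {0..1}"
  shows "c t \<in> fst \<kappa>" "snd \<kappa> (c t) \<in> cball (snd \<kappa> (c 0)) r"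
proof -
  note ch = atlas_chart [OF \<kappa>(1)]
  define p where "p = snd \<kappa> (c 0)"
  define V where "V = fst \<kappa> \<inter> snd \<kappa> -` ball p r"
  have "open V"
    unfolding V_def by (rule continuous_open_preimage [OF is_chartD(4,1) [OF ch] open_ball])
  have "c s \<in> V" if "s \<in> {0..1}" for s
  proof (rule ccontr)
    assume "c s \<notin> V"
    define T where "T = {0..1} \<inter> c -` (- V)"
    have "closed T"
      unfolding T_def
      using \<open>open V\<close>
      by (intro continuous_closed_preimage [OF geodesic_continuous] closed_atLeastAtMost closed_Compl)
    moreover have "bounded T"
      by (rule bounded_subset [OF bounded_closed_interval [of 0 1]]) (simp add: T_def)
    ultimately have "compact T"
      by (simp add: compact_eq_bounded_closed)
    moreover have "s \<in> T"
      using that \<open>c s \<notin> V\<close> by (simp add: T_def)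
    then have "T \<noteq> {}"
      by blast
    ultimately obtain t0 where t0: "t0 \<in> T" "\<And>t. t \<in> T \<Longrightarrow> t0 \<le> t"
      using compact_attains_inf [of T] by blast
    have "c 0 \<in> V"
      using \<kappa>(2) r(1) by (simp add: V_def p_def)
    with t0(1) have t01: "0 < t0" "t0 \<le> 1"
      by (cases "t0 = 0"; simp add: T_def)+
    have before: "c u \<in> V" if "u \<in> {0..<t0}" for u
    proof (rule ccontr)
      assume "c u \<notin> V"
      then have "u \<in> T"
        using that t01 by (simp add: T_def)
      then show False
        using t0(2) [OF \<open>u \<in> T\<close>] that by simp
    qed
    \<comment> \<open>The limit at the exit time has to be taken in the manifold, since coordinates
      mean nothing before the limit point is known to be in the chart. The image of the half-size
      ball is compact, hence closed in the Hausdorff space.\<close>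
    define K where "K = chart_inv \<kappa> ` cball p (r / 2)"
    have half: "cball p (r / 2) \<subseteq> snd \<kappa> ` fst \<kappa>"
      using subset_trans [OF subset_cball r(2)] r(1) by (simp add: p_def)
    have "compact K"
      unfolding K_def
      by (intro compact_continuous_image continuous_on_subset [OF is_chartD(5) [OF ch] half] compact_cball)
    then have "closed K"
      by (rule compact_imp_closed)
    have "K \<subseteq> V"
    proof
      fix y assume "y \<in> K"
      then obtain q where q: "q \<in> cball p (r / 2)" "y = chart_inv \<kappa> q"
        by (auto simp: K_def)
      note qD = subsetD [OF half q(1)]
      show "y \<in> V"
        unfolding V_def q(2) using chart_chart_inv [OF ch qD] chart_inv_in [OF ch qD] q(1) r(1) by simp
    qed
    have "c ` {0..<t0} \<subseteq> K"
    proof clarify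
      fix u assume u: "u \<in> {0..<t0}"
      have "sqrt m * norm (snd \<kappa> (c u) - snd \<kappa> (c 0)) \<le> curve_length A g c"
      proof (rule geodesic_displacement [where K = "cball (snd \<kappa> (c 0)) r", OF \<kappa>(1) _ _ _ _ m(1)])
        fix v assume "v \<in> {0..u}"
        then have "c v \<in> V"
          using u by (intro before) simp
        then show "c v \<in> fst \<kappa>" "snd \<kappa> (c v) \<in> cball (snd \<kappa> (c 0)) r"
          by (simp_all add: V_def p_def)
      next
        show "m * (norm w)\<^sup>2 \<le> gram A g \<kappa> w w q" if "q \<in> cball (snd \<kappa> (c 0)) r" for q w
          by (rule m(2) [OF that])
      qed (use u t01 in simp_all)
      then have "sqrt m * norm (snd \<kappa> (c u) - p) < sqrt m * (r / 2)"
        using len by (simp add: p_def)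
      then have "snd \<kappa> (c u) \<in> cball p (r / 2)"
        using m(1) by (simp add: dist_norm norm_minus_commute)
      then have "chart_inv \<kappa> (snd \<kappa> (c u)) \<in> K"
        unfolding K_def by (rule imageI)
      moreover have "c u \<in> fst \<kappa>"
        using before [OF u] by (simp add: V_def)
      ultimately show "c u \<in> K"
        using chart_inv_chart [OF ch, of "c u"] by simp
    qed
    moreover have cl: "closure {0..<t0} = {0..t0}"
      using t01 by simp
    moreover have "continuous_on {0..t0} c"
      by (rule continuous_on_subset [OF geodesic_continuous]) (use t01 in auto)
    ultimately have "c ` {0..t0} \<subseteq> K"
      using image_closure_subset [of "{0..<t0}" c K, unfolded cl] \<open>closed K\<close> by blast
    moreover have "c t0 \<in> c ` {0..t0}"
      using t01 by (intro imageI) simp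
    ultimately have "c t0 \<in> V"
      using \<open>K \<subseteq> V\<close> by blast
    then show False
      using t0(1) by (simp add: T_def)
  qed
  from this [OF t] show "c t \<in> fst \<kappa>" "snd \<kappa> (c t) \<in> cball (snd \<kappa> (c 0)) r"
    by (simp_all add: V_def p_def)
qed

text \<open>The lower bound \<open>m\<close> on the metric turns Riemannian length
  \<open>sqrt m * \<delta>\<close> into coordinate length \<open>\<delta>\<close>, and the geodesic
  equation bounds the acceleration by \<open>B\<close> times the squared speed.\<close>

lemma geodesic_initial_velocity:
  assumes \<kappa>: "\<kappa> \<in> A" "c 0 \<in> fst \<kappa>" and r: "r > 0" "cball (snd \<kappa> (c 0)) r \<subseteq> snd \<kappa> ` fst \<kappa>"
    and m: "m > 0" "\<And>q u. q \<in> cball (snd \<kappa> (c 0)) r \<Longrightarrow> m * (norm u)\<^sup>2 \<le> gram A g \<kappa> u u q"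
    and B: "B \<ge> 0" "\<And>q u v. q \<in> cball (snd \<kappa> (c 0)) r \<Longrightarrow>
      norm (christoffel A g \<kappa> q u v) \<le> B * norm u * norm v"
    and len: "curve_length A g c \<le> sqrt m * \<delta>" "\<delta> < r / 2" "B * \<delta> \<le> 1 / 2"
  shows "norm (velocity A {0..1} c 0 \<kappa> - (snd \<kappa> (c 1) - snd \<kappa> (c 0))) \<le> 2 * B * \<delta>\<^sup>2"
proof -
  have "sqrt m * \<delta> < sqrt m * (r / 2)"
    using m(1) len(2) by simp
  then have less: "curve_length A g c < sqrt m * (r / 2)"
    using len(1) by simp
  have ball: "c t \<in> fst \<kappa>" "snd \<kappa> (c t) \<in> cball (snd \<kappa> (c 0)) r" if "t \<in> {0..1}" for t
    by (rule geodesic_stays_in_ball [OF \<kappa> r m(1) _ less that], erule m(2))+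
  have cont: "continuous_on {0..1} (coord_velocity \<kappa>)"
    unfolding continuous_on_eq_continuous_within
    using has_vector_derivative_continuous [OF geodesic_derivatives(2) [OF \<kappa>(1) _ ball(1)]] by blast
  have "integral {0..1} (\<lambda>t. sqrt m * norm (coord_velocity \<kappa> t)) \<le> integral {0..1} speed"
  proof (rule Henstock_Kurzweil_Integration.integral_le)
    show "(\<lambda>t. sqrt m * norm (coord_velocity \<kappa> t)) integrable_on {0..1}"
      by (intro integrable_continuous_real continuous_intros cont)
    show "speed integrable_on {0..1}"
      by (rule integrable_continuous_real [OF geodesic_speed_continuous])
    show "sqrt m * norm (coord_velocity \<kappa> t) \<le> speed t" if "t \<in> {0..1}" for t
      by (rule coord_speed_le [OF \<kappa>(1) that ball(1) [OF that] m(1) m(2) [OF ball(2) [OF that]]])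
  qed
  then have "sqrt m * integral {0..1} (\<lambda>t. norm (coord_velocity \<kappa> t)) \<le> sqrt m * \<delta>"
    using len(1) by (simp add: curve_length_def)
  then have "integral {0..1} (\<lambda>t. norm (coord_velocity \<kappa> t)) \<le> \<delta>"
    using m(1) by simp
  then have "norm (coord_velocity \<kappa> 0 - ((snd \<kappa> \<circ> c) 1 - (snd \<kappa> \<circ> c) 0)) \<le> 2 * B * \<delta>\<^sup>2"
  proof (rule short_curve_almost_straight [rotated 3])
    fix t :: real assume t: "t \<in> {0..1}"
    show "(snd \<kappa> \<circ> c has_vector_derivative coord_velocity \<kappa> t) (at t within {0..1})"
      and "(coord_velocity \<kappa> has_vector_derivative
      - christoffel A g \<kappa> (snd \<kappa> (c t)) (coord_velocity \<kappa> t) (coord_velocity \<kappa> t))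
      (at t within {0..1})"
      by (rule geodesic_derivatives [OF \<kappa>(1) t ball(1) [OF t]])+
    show "norm (- christoffel A g \<kappa> (snd \<kappa> (c t)) (coord_velocity \<kappa> t) (coord_velocity \<kappa> t))
      \<le> B * (norm (coord_velocity \<kappa> t))\<^sup>2"
      using B(2) [OF ball(2) [OF t], of "coord_velocity \<kappa> t" "coord_velocity \<kappa> t"]
      by (simp add: power2_eq_square mult.assoc)
  qed (use B(1) len(3) in auto)
  then show ?thesis
    using \<kappa> by (simp add: velocity_def)
qed

end

end


context riemannian
begin

section \<open>Coordinate lines and the Riemannian distance\<close>

context
  fixes \<psi> :: "('m, 'e) chart" and I :: "real set" and p w :: 'e
  assumes \<psi>: "C1_coordinates A \<psi>"
    and I: "\<And>t. t \<in> I \<Longrightarrow> p + t *\<^sub>R w \<in> snd \<psi> ` fst \<psi>" "\<And>t. t \<in> I \<Longrightarrow> at t within I \<noteq> bot"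
begin

abbreviation (input) coord_line :: "real \<Rightarrow> 'm" where
  "coord_line t \<equiv> chart_inv \<psi> (p + t *\<^sub>R w)"

lemma coord_line_continuous: "t \<in> I \<Longrightarrow> continuous (at t within I) coord_line"
  unfolding continuous_within
  by (rule tendsto_chart_inv [OF C1_coordinatesD(1) [OF \<psi>] I(1)]) (auto intro!: tendsto_intros)

lemma coord_line_derivative:
  assumes "t \<in> I"
  shows "(snd \<psi> \<circ> coord_line has_vector_derivative w) (at t within I)"
proof (rule has_vector_derivative_transform [OF assms])
  show "((\<lambda>t. p + t *\<^sub>R w) has_vector_derivative w) (at t within I)"
    by (auto intro!: derivative_eq_intros)
qed (use chart_chart_inv [OF C1_coordinatesD(1) [OF \<psi>] I(1)] in simp)

lemma coord_line_velocity:
  assumes "t \<in> I"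
  shows "velocity A I coord_line t = coord_vector A \<psi> (coord_line t) w"
  by (rule velocity_eq_coord_vector [OF atlas \<psi> coord_line_continuous [OF assms] _ assms I(2) [OF assms]
      coord_line_derivative [OF assms]])
     (rule chart_inv_in [OF C1_coordinatesD(1) [OF \<psi>] I(1) [OF assms]])

text \<open>In another chart the derivative of the line is the derivative of the coordinate change
  applied to the constant \<open>w\<close>, which varies continuously. The general \<open>I\<close>
  covers closed intervals for the distance estimate and open ones for curves in the
  boundary.\<close>

lemma coord_line_C1: "C1_curve A I coord_line"
  unfolding C1_curve_def
proof (intro conjI ballI impI)
  show "continuous_on I coord_line"
    unfolding continuous_on_eq_continuous_within using coord_line_continuous by blast
  fix \<mu> t assume \<mu>: "\<mu> \<in> A" and t: "t \<in> I" "coord_line t \<in> fst \<mu>"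
  note ch = C1_coordinatesD(1) [OF \<psi>] atlas_chart [OF \<mu>] C1_coordinatesD(2) [OF \<psi> \<mu>]
  define D where "D s = frechet_derivative (transition \<psi> \<mu>) (at (p + s *\<^sub>R w)) w" for s
  have d: "(snd \<mu> \<circ> coord_line has_vector_derivative D s) (at s within I)"
    if s: "s \<in> I" "coord_line s \<in> fst \<mu>" for s
    using curve_change_chart [OF ch coord_line_continuous [OF s(1)] chart_inv_in [OF ch(1) I(1) [OF s(1)]]
        s(2,1) coord_line_derivative [OF s(1)]]
      chart_chart_inv [OF ch(1) I(1) [OF s(1)]] by (simp add: D_def)
  then show "snd \<mu> \<circ> coord_line differentiable (at t within I)"
    using t differentiableI_vector by blast
  have vd: "vector_derivative (snd \<mu> \<circ> coord_line) (at s within I) = D s"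
    if "s \<in> I" "coord_line s \<in> fst \<mu>" for s
    by (rule vector_derivative_within [OF I(2) [OF that(1)] d [OF that]])
  let ?E = "snd \<psi> ` (fst \<psi> \<inter> fst \<mu>)"
  have cE: "continuous_on ?E (\<lambda>q. frechet_derivative (transition \<psi> \<mu>) (at q) w)"
    using ch(3) by (simp add: Ck_compatible_def)
  have oE: "open ?E"
    by (rule open_chart_image [OF ch(1) is_chartD(1) [OF ch(2)]])
  have tE: "p + t *\<^sub>R w \<in> ?E"
    using chart_chart_inv [OF ch(1) I(1) [OF t(1)]] chart_inv_in [OF ch(1) I(1) [OF t(1)]] t(2)
    by (metis IntI imageI)
  have lin: "((\<lambda>s. p + s *\<^sub>R w) \<longlongrightarrow> p + t *\<^sub>R w) (at t within I)"
    by (auto intro!: tendsto_intros)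
  have "(D \<longlongrightarrow> D t) (at t within I)"
    unfolding D_def
    by (rule continuous_on_tendsto_compose [OF cE lin tE topological_tendstoD [OF lin oE tE]])
  moreover have "\<forall>\<^sub>F s in at t within I. D s = vector_derivative (snd \<mu> \<circ> coord_line) (at s within I)"
  proof -
    have "\<forall>\<^sub>F s in at t within I. coord_line s \<in> fst \<mu>"
      using coord_line_continuous [OF t(1)] unfolding continuous_within
      by (rule topological_tendstoD) (use is_chartD(1) [OF ch(2)] t(2) in auto)
    moreover have "\<forall>\<^sub>F s in at t within I. s \<in> I"
      by (simp add: eventually_at_filter)
    ultimately show ?thesis
      by eventually_elim (simp add: vd)
  qed
  ultimately show "continuous (at t within I)
      (\<lambda>s. vector_derivative (snd \<mu> \<circ> coord_line) (at s within I))"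
    unfolding continuous_within vd [OF t] by (rule Lim_transform_eventually)
qed

end

text \<open>The coordinate segment from \<open>p\<close> to \<open>p + w\<close> is an admissible
  competitor in the infimum, and its speed is at most \<open>sqrt M * norm w\<close>.\<close>

lemma riem_edist_le_coord:
  assumes \<kappa>: "\<kappa> \<in> A" and K: "K \<subseteq> snd \<kappa> ` fst \<kappa>" "\<And>t. t \<in> {0..1} \<Longrightarrow> p + t *\<^sub>R w \<in> K"
    and M: "\<And>q u. q \<in> K \<Longrightarrow> gram A g \<kappa> u u q \<le> M * (norm u)\<^sup>2"
  shows "riem_edist A g (chart_inv \<kappa> p) (chart_inv \<kappa> (p + w)) \<le> ennreal (sqrt M * norm w)"
proof -
  let ?c = "\<lambda>t. chart_inv \<kappa> (p + t *\<^sub>R w)"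
  note ch = atlas_chart [OF \<kappa>]
  have D: "p + t *\<^sub>R w \<in> snd \<kappa> ` fst \<kappa>" if "t \<in> {0..1}" for t
    using K that by blast
  have C1: "C1_curve A {a..b} ?c" if "0 \<le> a" "a < b" "b \<le> 1" for a b
    by (rule coord_line_C1 [OF atlas_coordinates [OF \<kappa>]])
       (use that D in \<open>auto simp: trivial_limit_within\<close>)
  have "continuous_on {0..1} ?c"
    using C1 [of 0 1] by (simp add: C1_curve_def)
  then have pw: "piecewise_C1_curve A ?c"
    unfolding piecewise_C1_curve_def using C1 by (intro conjI exI [of _ "{}"]) auto
  have sp: "tnorm g (?c t) (velocity A {0..1} ?c t) = sqrt (gram A g \<kappa> w w (p + t *\<^sub>R w))"
    if t: "t \<in> {0..1}" for t
    using coord_line_velocity [OF atlas_coordinates [OF \<kappa>] D at_within_unit_interval_neq_bot t]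
    by (simp add: tnorm_def gram_def)
  have "curve_length A g ?c = integral {0..1} (\<lambda>t. sqrt (gram A g \<kappa> w w (p + t *\<^sub>R w)))"
    unfolding curve_length_def by (rule integral_cong [OF sp])
  also have "\<dots> \<le> integral {0..1} (\<lambda>t::real. sqrt M * norm w)"
  proof (rule Henstock_Kurzweil_Integration.integral_le)
    have "continuous_on {0..1} (\<lambda>t. gram A g \<kappa> w w (p + t *\<^sub>R w))"
      by (rule gram_continuous_on [OF \<kappa>]) (use D in \<open>auto intro!: continuous_intros\<close>)
    then show "(\<lambda>t. sqrt (gram A g \<kappa> w w (p + t *\<^sub>R w))) integrable_on {0..1}"
      by (intro integrable_continuous_real continuous_on_real_sqrt)
    show "(\<lambda>t::real. sqrt M * norm w) integrable_on {0..1}"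
      by (rule integrable_const_ivl)
    show "sqrt (gram A g \<kappa> w w (p + t *\<^sub>R w)) \<le> sqrt M * norm w" if "t \<in> {0..1}" for t
      using real_sqrt_le_mono [OF M [OF K(2) [OF that], of w]] by (simp add: real_sqrt_mult)
  qed
  finally have len: "curve_length A g ?c \<le> sqrt M * norm w"
    by simp
  have "riem_edist A g (chart_inv \<kappa> p) (chart_inv \<kappa> (p + w)) \<le> ennreal (curve_length A g ?c)"
    unfolding riem_edist_def by (rule INF_lower) (use pw in simp)
  also have "\<dots> \<le> ennreal (sqrt M * norm w)"
    by (rule ennreal_leI [OF len])
  finally show ?thesis .
qed

lemma riem_edist_near:
  assumes \<kappa>: "\<kappa> \<in> A" and x: "x \<in> fst \<kappa>" and r: "cball (snd \<kappa> x) r \<subseteq> snd \<kappa> ` fst \<kappa>"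
    and M: "\<And>q u. q \<in> cball (snd \<kappa> x) r \<Longrightarrow> gram A g \<kappa> u u q \<le> M * (norm u)\<^sup>2"
    and y: "y \<in> fst \<kappa>" "norm (snd \<kappa> y - snd \<kappa> x) \<le> r"
  shows "riem_edist A g x y \<le> ennreal (sqrt M * norm (snd \<kappa> y - snd \<kappa> x))"
proof -
  let ?p = "snd \<kappa> x" and ?w = "snd \<kappa> y - snd \<kappa> x"
  have "?p + t *\<^sub>R ?w \<in> cball ?p r" if "t \<in> {0..1}" for t
  proof -
    have "norm (t *\<^sub>R ?w) \<le> 1 * norm ?w"
      unfolding norm_scaleR by (rule mult_right_mono) (use that in auto)
    then show ?thesis
      using y(2) by (simp add: dist_norm)
  qed
  from riem_edist_le_coord [OF \<kappa> r this M] show ?thesis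
    using chart_inv_chart [OF atlas_chart [OF \<kappa>]] x y(1) by simp
qed

lemma atlas_cball:
  assumes \<kappa>: "\<kappa> \<in> A" and x: "x \<in> fst \<kappa>"
  obtains r where "r > 0" "cball (snd \<kappa> x) r \<subseteq> snd \<kappa> ` fst \<kappa>"
  using open_contains_cball [THEN iffD1, OF is_chartD(2) [OF atlas_chart [OF \<kappa>]], rule_format,
      OF imageI [OF x]] by blast

text \<open>Relates the Riemannian distance to the topology of the manifold, so that the convex ball
  supplied by prox-regularity is a convex neighborhood of its center.\<close>

lemma in_interior_riem_ball:
  assumes "\<epsilon> > 0"
  shows "x \<in> interior (riem_ball A g x \<epsilon>)"
proof -
  obtain \<kappa> where \<kappa>: "\<kappa> \<in> A" "x \<in> fst \<kappa>"
    by (rule atlas_cover)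
  note ch = atlas_chart [OF \<kappa>(1)]
  obtain r where r: "r > 0" "cball (snd \<kappa> x) r \<subseteq> snd \<kappa> ` fst \<kappa>"
    by (rule atlas_cball [OF \<kappa>])
  obtain m M where M: "m > 0" "M > 0"
    "\<And>q u. q \<in> cball (snd \<kappa> x) r \<Longrightarrow> m * (norm u)\<^sup>2 \<le> gram A g \<kappa> u u q"
    "\<And>q u. q \<in> cball (snd \<kappa> x) r \<Longrightarrow> gram A g \<kappa> u u q \<le> M * (norm u)\<^sup>2"
    using gram_bounds [OF \<kappa>(1) compact_cball r(2)] by blast
  \<comment> \<open>Within \<open>r\<close> the metric bound \<open>M\<close> holds along the
    segment; within \<open>\<epsilon> / sqrt M\<close> the segment has length less than
    \<open>\<epsilon>\<close>.\<close>
  define s where "s = min r (\<epsilon> / sqrt M)"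
  have s: "s > 0" "s \<le> r" "s \<le> \<epsilon> / sqrt M"
    using r(1) M(2) assms by (simp_all add: s_def)
  define V where "V = fst \<kappa> \<inter> snd \<kappa> -` ball (snd \<kappa> x) s"
  have "open V"
    unfolding V_def by (rule continuous_open_preimage [OF is_chartD(4,1) [OF ch] open_ball])
  moreover have "x \<in> V"
    using \<kappa>(2) s(1) by (simp add: V_def)
  moreover have "V \<subseteq> riem_ball A g x \<epsilon>"
  proof
    fix y assume "y \<in> V"
    then have y: "y \<in> fst \<kappa>" "norm (snd \<kappa> y - snd \<kappa> x) < s"
      by (simp_all add: V_def dist_norm norm_minus_commute)
    have "riem_edist A g x y \<le> ennreal (sqrt M * norm (snd \<kappa> y - snd \<kappa> x))"
      by (rule riem_edist_near [OF \<kappa> r(2) M(4) y(1)]) (use y(2) s(2) in simp_all)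
    also have "sqrt M * norm (snd \<kappa> y - snd \<kappa> x) < \<epsilon>"
      using less_le_trans [OF y(2) s(3)] M(2) by (simp add: pos_less_divide_eq mult.commute)
    then have "ennreal (sqrt M * norm (snd \<kappa> y - snd \<kappa> x)) < ennreal \<epsilon>"
      using M(2) by (simp add: ennreal_less_iff)
    finally show "y \<in> riem_ball A g x \<epsilon>"
      by (simp add: riem_ball_def)
  qed
  ultimately show ?thesis
    by (rule interiorI)
qed

section \<open>The inverse exponential map in coordinates\<close>

text \<open>A minimizing geodesic is no longer than the bound obtained from the coordinate segment,
  so its length is at most \<open>sqrt M\<close> times the coordinate distance. The estimate of its
  initial velocity then gives an error quadratic in that distance.\<close>

lemma exp_inv_near:
  assumes \<kappa>: "\<kappa> \<in> A" and x: "x \<in> fst \<kappa>"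
  obtains \<rho> C where "\<rho> > 0" "C \<ge> 0"
    "\<And>y c. y \<in> fst \<kappa> \<Longrightarrow> norm (snd \<kappa> y - snd \<kappa> x) < \<rho> \<Longrightarrow> min_geodesic A g x y c \<Longrightarrow>
      norm (exp_inv A g x y \<kappa> - (snd \<kappa> y - snd \<kappa> x)) \<le> C * (norm (snd \<kappa> y - snd \<kappa> x))\<^sup>2"
proof -
  obtain r where r: "r > 0" "cball (snd \<kappa> x) r \<subseteq> snd \<kappa> ` fst \<kappa>"
    by (rule atlas_cball [OF \<kappa> x])
  obtain m M where M: "m > 0" "M > 0"
    "\<And>q u. q \<in> cball (snd \<kappa> x) r \<Longrightarrow> m * (norm u)\<^sup>2 \<le> gram A g \<kappa> u u q"
    "\<And>q u. q \<in> cball (snd \<kappa> x) r \<Longrightarrow> gram A g \<kappa> u u q \<le> M * (norm u)\<^sup>2"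
    using gram_bounds [OF \<kappa> compact_cball r(2)] by blast
  obtain B where B: "B \<ge> 0" "\<And>q u v. q \<in> cball (snd \<kappa> x) r \<Longrightarrow>
      norm (christoffel A g \<kappa> q u v) \<le> B * norm u * norm v"
    using christoffel_bound [OF \<kappa> compact_cball r(2)] by blast
  \<comment> \<open>The distortion ratio of the metric: a length \<open>sqrt M * n\<close> equals
    \<open>sqrt m * (a * n)\<close>, so the estimate is applied with
    \<open>\<delta> = a * n\<close>.\<close>
  define a where "a = sqrt M / sqrt m"
  have a: "a > 0"
    using M by (simp add: a_def)
  \<comment> \<open>In turn: the segment stays in the ball, the geodesic stays in the ball, and
    \<open>B * (a * n)\<close> is at most 1/2. The summand 1 avoids a zero denominator when
    \<open>B = 0\<close>.\<close>
  define \<rho> where "\<rho> = min r (min (r / (2 * a)) (1 / (2 * a * (B + 1))))"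
  have \<rho>: "\<rho> > 0" "\<rho> \<le> r" "\<rho> \<le> r / (2 * a)" "\<rho> \<le> 1 / (2 * a * (B + 1))"
    using r(1) a B(1) by (simp_all add: \<rho>_def)
  show ?thesis
  proof (rule that [of \<rho> "2 * B * a\<^sup>2"])
    show "\<rho> > 0" "2 * B * a\<^sup>2 \<ge> 0"
      using \<rho>(1) B(1) by simp_all
    fix y c0 assume y: "y \<in> fst \<kappa>" "norm (snd \<kappa> y - snd \<kappa> x) < \<rho>" and c0: "min_geodesic A g x y c0"
    define n where "n = norm (snd \<kappa> y - snd \<kappa> x)"
    define c where "c = (SOME c. min_geodesic A g x y c)"
    have n: "0 \<le> n" "n < \<rho>"
      using y(2) by (simp_all add: n_def)
    \<comment> \<open>\<open>c0\<close> witnesses existence only; the estimate is for the geodesic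
      that \<open>exp_inv\<close> selects.\<close>
    have "min_geodesic A g x y c"
      unfolding c_def using c0 by (rule someI [where P = "min_geodesic A g x y"])
    then have c: "geodesic A g c" "c 0 = x" "c 1 = y" "ennreal (curve_length A g c) = riem_edist A g x y"
      unfolding min_geodesic_def by blast+
    have "riem_edist A g x y \<le> ennreal (sqrt M * n)"
      unfolding n_def by (rule riem_edist_near [OF \<kappa> x r(2) M(4) y(1)]) (use y(2) \<rho>(2) in simp_all)
    then have "curve_length A g c \<le> sqrt M * n"
      unfolding c(4) [symmetric] using n M(2) by (simp add: ennreal_le_iff)
    then have len: "curve_length A g c \<le> sqrt m * (a * n)"
      using M(1) by (simp add: a_def)
    have "n < r / (2 * a)"
      using n(2) \<rho>(3) by simp
    then have "2 * a * n < r"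
      using a by (simp add: pos_less_divide_eq mult.commute)
    then have small: "a * n < r / 2"
      by simp
    have "n \<le> 1 / (2 * a * (B + 1))"
      using n(2) \<rho>(4) by simp
    then have "n * (2 * a * (B + 1)) \<le> 1"
      using a B(1) by (simp add: pos_le_divide_eq)
    then have "B * (a * n) + a * n \<le> 1 / 2"
      by (simp add: algebra_simps)
    then have curv: "B * (a * n) \<le> 1 / 2"
      using mult_nonneg_nonneg [OF less_imp_le [OF a] n(1)] by simp
    have "norm (velocity A {0..1} c 0 \<kappa> - (snd \<kappa> (c 1) - snd \<kappa> (c 0))) \<le> 2 * B * (a * n)\<^sup>2"
      by (rule geodesic_initial_velocity [OF c(1) \<kappa> _ r(1) _ M(1) _ B(1) _ len small curv])
         (simp_all add: c(2) x r(2) M(3) B(2))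
    then show "norm (exp_inv A g x y \<kappa> - (snd \<kappa> y - snd \<kappa> x))
        \<le> 2 * B * a\<^sup>2 * (norm (snd \<kappa> y - snd \<kappa> x))\<^sup>2"
      by (simp add: exp_inv_def c_def [symmetric] c(2,3) n_def power_mult_distrib mult.assoc)
  qed
qed

text \<open>The Bouligand tangent cone is therefore the contingent cone of coordinate space.\<close>

lemma exp_inv_quotient_tendsto_iff:
  fixes z :: "nat \<Rightarrow> 'm" and t :: "nat \<Rightarrow> real"
  assumes \<kappa>: "\<kappa> \<in> A" and x: "x \<in> fst \<kappa>" and z: "z \<longlonglongrightarrow> x" and t: "\<And>i. t i > 0"
    and geo: "\<And>i. \<exists>c. min_geodesic A g x (z i) c"
  shows "(\<lambda>i. exp_inv A g x (z i) \<kappa> /\<^sub>R t i) \<longlonglongrightarrow> w \<longleftrightarrow>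
    (\<lambda>i. (snd \<kappa> (z i) - snd \<kappa> x) /\<^sub>R t i) \<longlonglongrightarrow> w"
proof -
  define d where "d i = snd \<kappa> (z i) - snd \<kappa> x" for i
  define e where "e i = exp_inv A g x (z i) \<kappa>" for i
  obtain \<rho> C where C: "\<rho> > 0" "C \<ge> 0"
    "\<And>y c. y \<in> fst \<kappa> \<Longrightarrow> norm (snd \<kappa> y - snd \<kappa> x) < \<rho> \<Longrightarrow> min_geodesic A g x y c \<Longrightarrow>
      norm (exp_inv A g x y \<kappa> - (snd \<kappa> y - snd \<kappa> x)) \<le> C * (norm (snd \<kappa> y - snd \<kappa> x))\<^sup>2"
    using exp_inv_near [OF \<kappa> x] by blast
  have d0: "d \<longlonglongrightarrow> 0"
    using tendsto_diff [OF tendsto_chart [OF atlas_chart [OF \<kappa>] x z] tendsto_const [of "snd \<kappa> x"]]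
    by (simp add: d_def [abs_def])
  then have Cd0: "(\<lambda>i. C * norm (d i)) \<longlonglongrightarrow> 0"
    using tendsto_mult [OF tendsto_const [of C] tendsto_norm [OF d0]] by simp
  have "\<forall>\<^sub>F i in sequentially. z i \<in> fst \<kappa>"
    by (rule topological_tendstoD [OF z is_chartD(1) [OF atlas_chart [OF \<kappa>]] x])
  moreover have "\<forall>\<^sub>F i in sequentially. norm (d i) < \<rho>"
    using order_tendstoD(2) [OF tendsto_norm [OF d0], of \<rho>] C(1) by simp
  ultimately have est: "\<forall>\<^sub>F i in sequentially. norm (e i - d i) \<le> C * (norm (d i))\<^sup>2"
  proof eventually_elim
    case (elim i)
    then show ?case
      unfolding e_def d_def using geo [of i] C(3) [of "z i"] by blast
  qed
  have est_t: "norm ((e i - d i) /\<^sub>R t i) \<le> C * norm (d i) * norm (d i /\<^sub>R t i)"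
    if "norm (e i - d i) \<le> C * (norm (d i))\<^sup>2" for i
    using mult_left_mono [OF that, of "inverse (t i)"] t [of i]
    by (simp add: power2_eq_square mult_ac)
  \<comment> \<open>The error is \<open>C * norm (d i)\<close>, which tends to 0, times the norm of
    a convergent quotient.\<close>
  have "(\<lambda>i. (e i - d i) /\<^sub>R t i) \<longlonglongrightarrow> 0" if w: "(\<lambda>i. d i /\<^sub>R t i) \<longlonglongrightarrow> w"
  proof (rule Lim_null_comparison)
    show "\<forall>\<^sub>F i in sequentially. norm ((e i - d i) /\<^sub>R t i) \<le> C * norm (d i) * norm (d i /\<^sub>R t i)"
      using est by eventually_elim (rule est_t)
    show "(\<lambda>i. C * norm (d i) * norm (d i /\<^sub>R t i)) \<longlonglongrightarrow> 0"
      using tendsto_mult [OF Cd0 tendsto_norm [OF w]] by simp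
  qed
  moreover have "(\<lambda>i. (e i - d i) /\<^sub>R t i) \<longlonglongrightarrow> 0" if w: "(\<lambda>i. e i /\<^sub>R t i) \<longlonglongrightarrow> w"
  proof (rule Lim_null_comparison)
    have half: "\<forall>\<^sub>F i in sequentially. C * norm (d i) < 1 / 2"
      using order_tendstoD(2) [OF Cd0, of "1 / 2"] by simp
    \<comment> \<open>Here convergence is known for \<open>e\<close>, whereas the error is measured
      by \<open>d\<close>. Once \<open>C * norm (d i)\<close> is below 1/2, the error is at most
      half of \<open>norm (d i)\<close>, so \<open>norm (d i)\<close> is at most
      \<open>2 * norm (e i)\<close>.\<close>
    show "\<forall>\<^sub>F i in sequentially. norm ((e i - d i) /\<^sub>R t i) \<le> C * norm (d i) * (2 * norm (e i /\<^sub>R t i))"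
      using est half
    proof eventually_elim
      case (elim i)
      have "norm (e i - d i) \<le> 1 / 2 * norm (d i)"
        using elim(1) mult_right_mono [OF less_imp_le [OF elim(2)], of "norm (d i)"]
        by (simp add: power2_eq_square mult.assoc)
      then have "norm (d i) \<le> 2 * norm (e i)"
        using norm_triangle_ineq2 [of "d i" "e i"] by (simp add: norm_minus_commute)
      then have "norm (d i /\<^sub>R t i) \<le> 2 * norm (e i /\<^sub>R t i)"
        using t [of i] mult_left_mono [of "norm (d i)" "2 * norm (e i)" "inverse (t i)"] by simp
      then have "C * norm (d i) * norm (d i /\<^sub>R t i) \<le> C * norm (d i) * (2 * norm (e i /\<^sub>R t i))"
        using C(2) by (intro mult_left_mono) auto
      then show ?case
        using est_t [OF elim(1)] by linarith
    qed
    show "(\<lambda>i. C * norm (d i) * (2 * norm (e i /\<^sub>R t i))) \<longlonglongrightarrow> 0"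
      using tendsto_mult [OF Cd0 tendsto_mult [OF tendsto_const [of 2] tendsto_norm [OF w]]] by simp
  qed
  ultimately show ?thesis
    unfolding d_def [symmetric] e_def [symmetric]
    using tendsto_add [of "\<lambda>i. (e i - d i) /\<^sub>R t i" 0 sequentially "\<lambda>i. d i /\<^sub>R t i" w]
      tendsto_diff [of "\<lambda>i. e i /\<^sub>R t i" w sequentially "\<lambda>i. (e i - d i) /\<^sub>R t i" 0]
    by (auto simp: scaleR_diff_right)
qed

end


section \<open>The tangent cones at the boundary\<close>

text \<open>The linearization error is \<open>E (d i) * norm (d i)\<close>; divided by
  \<open>t i\<close>, it is a null sequence times a convergent one. It carries tangent directions
  through coordinate changes and along curves.\<close>

lemma tendsto_difference_quotient:
  fixes F :: "'a::real_normed_vector \<Rightarrow> 'b::real_normed_vector"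
  assumes F: "(F has_derivative D) (at p)" and d: "d \<longlonglongrightarrow> 0"
    and w: "(\<lambda>i. d i /\<^sub>R t i) \<longlonglongrightarrow> w" and t: "\<And>i. t i > 0"
  shows "(\<lambda>i. (F (p + d i) - F p) /\<^sub>R t i) \<longlonglongrightarrow> D w"
proof -
  have bl: "bounded_linear D"
    by (rule has_derivative_bounded_linear [OF F])
  define E where "E h = norm (F (p + h) - F p - D h) / norm h" for h
  \<comment> \<open>Division by zero gives \<open>E 0 = 0\<close>, so that \<open>E\<close> is
    continuous at 0 and terms with \<open>d i = 0\<close> are covered.\<close>
  have "isCont E 0"
    using F unfolding has_derivative_at isCont_def E_def by simp
  then have "(\<lambda>i. E (d i)) \<longlonglongrightarrow> E 0"
    using d by (rule isCont_tendsto_compose)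
  then have E: "(\<lambda>i. E (d i)) \<longlonglongrightarrow> 0"
    by (simp add: E_def)
  have "(\<lambda>i. (F (p + d i) - F p - D (d i)) /\<^sub>R t i) \<longlonglongrightarrow> 0"
  proof (rule Lim_null_comparison)
    have "norm ((F (p + d i) - F p - D (d i)) /\<^sub>R t i) \<le> E (d i) * norm (d i /\<^sub>R t i)" for i
      using t [of i] linear_0 [OF bounded_linear.linear [OF bl]]
      by (cases "d i = 0") (simp_all add: E_def)
    then show "\<forall>\<^sub>F i in sequentially.
        norm ((F (p + d i) - F p - D (d i)) /\<^sub>R t i) \<le> E (d i) * norm (d i /\<^sub>R t i)"
      by simp
    show "(\<lambda>i. E (d i) * norm (d i /\<^sub>R t i)) \<longlonglongrightarrow> 0"
      using tendsto_mult [OF E tendsto_norm [OF w]] by simp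
  qed
  from tendsto_add [OF this bounded_linear.tendsto [OF bl w]]
  show ?thesis
    by (simp add: linear_scale [OF bounded_linear.linear [OF bl]] flip: scaleR_add_right)
qed

section \<open>The two inclusions between tangent cones and the tangent space of the
  boundary\<close>

context riemannian
begin

lemma tangent_sub_subset_bouligand:
  assumes U: "convex_nbhd A g x U" and NB: "N \<subseteq> B" and v: "v \<in> tangent_space_sub A N x"
  shows "v \<in> bouligand_cone A g B x"
proof -
  obtain c \<delta> where \<delta>: "\<delta> > 0" and c: "C1_curve A {-\<delta><..<\<delta>} c" "c ` {-\<delta><..<\<delta>} \<subseteq> N" "c 0 = x"
    and v: "v = velocity A {-\<delta><..<\<delta>} c 0"
    using v unfolding tangent_space_sub_def by blast
  have 0: "(0::real) \<in> {-\<delta><..<\<delta>}"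
    using \<delta> by simp
  have at0: "at (0::real) within {-\<delta><..<\<delta>} = at 0"
    by (rule at_within_open [OF 0 open_greaterThanLessThan])
  have "continuous_on {-\<delta><..<\<delta>} c"
    using c(1) unfolding C1_curve_def by blast
  then have "continuous (at 0 within {-\<delta><..<\<delta>}) c"
    unfolding continuous_on_eq_continuous_within using 0 by blast
  then have cont: "c \<midarrow>0\<rightarrow> x"
    unfolding continuous_within at0 c(3) .
  have der: "(snd \<kappa> \<circ> c has_vector_derivative v \<kappa>) (at 0)" if "\<kappa> \<in> A" "x \<in> fst \<kappa>" for \<kappa>
  proof -
    have "snd \<kappa> \<circ> c differentiable (at 0 within {-\<delta><..<\<delta>})"
      using c(1) 0 that unfolding C1_curve_def c(3) [symmetric] by blast
    then have "(snd \<kappa> \<circ> c has_vector_derivative vector_derivative (snd \<kappa> \<circ> c) (at 0 within {-\<delta><..<\<delta>}))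
        (at 0 within {-\<delta><..<\<delta>})"
      by (simp only: vector_derivative_works)
    then show ?thesis
      using that c(3) by (simp add: v velocity_def at0)
  qed
  obtain \<kappa>0 where \<kappa>0: "\<kappa>0 \<in> A" "x \<in> fst \<kappa>0"
    by (rule atlas_cover)
  have "v = coord_vector A \<kappa>0 (c 0) (v \<kappa>0)"
    unfolding v
    by (rule velocity_eq_coord_vector [OF atlas atlas_coordinates [OF \<kappa>0(1)]])
       (use 0 cont der [OF \<kappa>0] \<kappa>0(2) in \<open>simp_all add: at0 c(3) continuous_within v [symmetric]\<close>)
  then have vT: "v \<in> tangent_space A x"
    using coord_vector_in_tangent_space [OF atlas atlas_coordinates [OF \<kappa>0(1)] \<kappa>0(2), of "v \<kappa>0"]
    by (simp add: c(3))
  \<comment> \<open>With \<open>i + 1\<close> the term at \<open>i = 0\<close> would be the excluded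
    end point \<open>\<delta>\<close>.\<close>
  define s where "s i = \<delta> / real (i + 2)" for i
  have s: "s i > 0" "s i < \<delta>" for i
  proof -
    have "\<delta> * 1 < \<delta> * real (i + 2)"
      using \<delta> by (intro mult_strict_left_mono) simp_all
    then show "s i > 0" "s i < \<delta>"
      using \<delta> by (simp_all add: s_def pos_divide_less_eq)
  qed
  have s0: "s \<longlonglongrightarrow> 0"
    unfolding s_def by (rule LIMSEQ_ignore_initial_segment [OF lim_const_over_n])
  have "(\<lambda>i. c (s i)) \<longlonglongrightarrow> x"
    using s(1) by (intro tendsto_compose_eventually [OF cont s0] always_eventually) (simp add: less_imp_neq [symmetric])
  then have "\<forall>\<^sub>F i in sequentially. c (s i) \<in> interior U"
    by (rule topological_tendstoD) (use U in \<open>auto simp: convex_nbhd_def\<close>)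
  then obtain k where k: "\<And>i. i \<ge> k \<Longrightarrow> c (s i) \<in> interior U"
    unfolding eventually_sequentially by blast
  \<comment> \<open>The cone demands all points of the sequence in \<open>U\<close>, not only
    eventually, so the first \<open>k\<close> samples are dropped.\<close>
  define t where "t i = s (i + k)" for i
  define z where "z i = c (t i)" for i
  have t: "t i > 0" "t i \<in> {-\<delta><..<\<delta>}" for i
    using s [of "i + k"] \<delta> by (simp_all add: t_def)
  have t0: "t \<longlonglongrightarrow> 0"
    unfolding t_def by (rule LIMSEQ_ignore_initial_segment [OF s0])
  have z: "z \<longlonglongrightarrow> x"
    unfolding z_def t_def by (rule LIMSEQ_ignore_initial_segment) fact
  have zU: "z i \<in> U" for i
    using k [of "i + k"] interior_subset [of U] by (auto simp: z_def t_def)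
  have zB: "z i \<in> B" for i
    unfolding z_def using c(2) NB t(2) [of i] by blast
  have geo: "\<exists>c. min_geodesic A g x (z i) c" for i
    using U zU interior_subset [of U] unfolding convex_nbhd_def convex_set_def by blast
  have "(\<lambda>i. exp_inv A g x (z i) \<kappa> /\<^sub>R t i) \<longlonglongrightarrow> v \<kappa>" if \<kappa>: "\<kappa> \<in> A" "x \<in> fst \<kappa>" for \<kappa>
    unfolding exp_inv_quotient_tendsto_iff [where t = t, OF \<kappa> z t(1) geo]
  proof -
    have "t i /\<^sub>R t i = 1" for i
      using t(1) [of i] by simp
    then have "(\<lambda>i. t i /\<^sub>R t i) \<longlonglongrightarrow> 1"
      by simp
    \<comment> \<open>The increments are the times \<open>t i\<close> themselves; their quotients by
      \<open>t i\<close> are constantly 1, and the derivative at 1 is the velocity.\<close>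
    from tendsto_difference_quotient [OF der [OF \<kappa>, unfolded has_vector_derivative_def] t0 this t(1)]
    show "(\<lambda>i. (snd \<kappa> (z i) - snd \<kappa> x) /\<^sub>R t i) \<longlonglongrightarrow> v \<kappa>"
      by (simp add: z_def c(3))
  qed
  then show ?thesis
    unfolding bouligand_cone_def using vT U zU zB t(1) z t0 by blast
qed

text \<open>The passage to a chart outside the atlas: the inverse exponential map is replaced by
  coordinate differences in \<open>\<kappa>\<close>, and the derivative of the coordinate change
  carries the limit of the quotients to \<open>\<psi>\<close>.\<close>

lemma bouligand_in_coordinates:
  assumes v: "v \<in> bouligand_cone A g B x" and \<kappa>: "\<kappa> \<in> A" "x \<in> fst \<kappa>"
    and \<psi>: "C1_coordinates A \<psi>" "x \<in> fst \<psi>"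
  obtains z t where "\<And>i::nat. z i \<in> B" "\<And>i. t i > (0::real)" "z \<longlonglongrightarrow> x"
    "(\<lambda>i. (snd \<psi> (z i) - snd \<psi> x) /\<^sub>R t i) \<longlonglongrightarrow>
      frechet_derivative (transition \<kappa> \<psi>) (at (snd \<kappa> x)) (v \<kappa>)"
proof -
  obtain U z t where U: "convex_nbhd A g x U" and zt: "\<forall>i::nat. z i \<in> U \<inter> B \<and> t i > (0::real)"
    and z: "z \<longlonglongrightarrow> x" and e: "\<forall>\<kappa>\<in>A. x \<in> fst \<kappa> \<longrightarrow> (\<lambda>i. exp_inv A g x (z i) \<kappa> /\<^sub>R t i) \<longlonglongrightarrow> v \<kappa>"
    using v unfolding bouligand_cone_def by blast
  have t: "t i > 0" and zU: "z i \<in> U" and zB: "z i \<in> B" for i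
    using zt by blast+
  have geo: "\<exists>c. min_geodesic A g x (z i) c" for i
    using U zU interior_subset [of U] unfolding convex_nbhd_def convex_set_def by blast
  have w: "(\<lambda>i. (snd \<kappa> (z i) - snd \<kappa> x) /\<^sub>R t i) \<longlonglongrightarrow> v \<kappa>"
    using e \<kappa> exp_inv_quotient_tendsto_iff [where t = t, OF \<kappa> z t geo] by blast
  note ch = atlas_chart [OF \<kappa>(1)]
  have d: "(\<lambda>i. snd \<kappa> (z i) - snd \<kappa> x) \<longlonglongrightarrow> 0"
    using tendsto_diff [OF tendsto_chart [OF ch \<kappa>(2) z] tendsto_const [of "snd \<kappa> x"]] by simp
  let ?F = "transition \<kappa> \<psi>"
  have "(\<lambda>i. (?F (snd \<kappa> x + (snd \<kappa> (z i) - snd \<kappa> x)) - ?F (snd \<kappa> x)) /\<^sub>R t i) \<longlonglongrightarrow>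
      frechet_derivative ?F (at (snd \<kappa> x)) (v \<kappa>)"
    by (rule tendsto_difference_quotient [OF transition_has_derivative d w t])
       (use C1_coordinatesD(3) [OF \<psi>(1) \<kappa>(1)] \<kappa>(2) \<psi>(2) in simp_all)
  moreover have "\<forall>\<^sub>F i in sequentially.
      (?F (snd \<kappa> x + (snd \<kappa> (z i) - snd \<kappa> x)) - ?F (snd \<kappa> x)) /\<^sub>R t i = (snd \<psi> (z i) - snd \<psi> x) /\<^sub>R t i"
    using topological_tendstoD [OF z is_chartD(1) [OF ch] \<kappa>(2)]
    by eventually_elim
       (simp add: transition_def chart_inv_chart [OF ch \<kappa>(2)] chart_inv_chart [OF ch])
  ultimately have "(\<lambda>i. (snd \<psi> (z i) - snd \<psi> x) /\<^sub>R t i) \<longlonglongrightarrow>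
      frechet_derivative ?F (at (snd \<kappa> x)) (v \<kappa>)"
    by (rule Lim_transform_eventually)
  then show thesis
    by (rule that [OF zB t z])
qed

lemma sequence_meets_half_ball:
  fixes z :: "nat \<Rightarrow> 'm" and t :: "nat \<Rightarrow> real"
  assumes \<psi>: "is_chart \<psi>" "x \<in> fst \<psi>" and z: "z \<longlonglongrightarrow> x" and t: "\<And>i. t i > 0"
    and w: "(\<lambda>i. (snd \<psi> (z i) - snd \<psi> x) /\<^sub>R t i) \<longlonglongrightarrow> w" and n: "w \<bullet> n > 0" and r: "r > 0"
  obtains i where "z i \<in> fst \<psi>" "snd \<psi> (z i) \<in> ball (snd \<psi> x) r" "(snd \<psi> (z i) - snd \<psi> x) \<bullet> n > 0"
proof -
  have "\<forall>\<^sub>F i in sequentially. z i \<in> fst \<psi>"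
    by (rule topological_tendstoD [OF z is_chartD(1) [OF \<psi>(1)] \<psi>(2)])
  moreover have "\<forall>\<^sub>F i in sequentially. snd \<psi> (z i) \<in> ball (snd \<psi> x) r"
    by (rule topological_tendstoD [OF tendsto_chart [OF \<psi> z] open_ball]) (use r in simp)
  moreover have "\<forall>\<^sub>F i in sequentially. ((snd \<psi> (z i) - snd \<psi> x) /\<^sub>R t i) \<bullet> n > 0"
    by (rule order_tendstoD(1) [OF tendsto_inner [OF w tendsto_const] n])
  ultimately have "\<forall>\<^sub>F i in sequentially. z i \<in> fst \<psi> \<and> snd \<psi> (z i) \<in> ball (snd \<psi> x) r \<and>
      (snd \<psi> (z i) - snd \<psi> x) \<bullet> n > 0"
  proof eventually_elim
    case (elim i)
    then show ?case
      using t [of i] by (simp add: zero_less_mult_iff)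
  qed
  then obtain i where "z i \<in> fst \<psi> \<and> snd \<psi> (z i) \<in> ball (snd \<psi> x) r \<and>
      (snd \<psi> (z i) - snd \<psi> x) \<bullet> n > 0"
    using eventually_happens by fastforce
  then show thesis
    using that by blast
qed

text \<open>Once the coordinate vector \<open>w\<close> is in \<open>L\<close>, the line through
  \<open>p\<close> in direction \<open>w\<close> stays in \<open>L\<close>; pulled back by the slice
  chart it is a curve in the boundary with velocity \<open>v\<close>.\<close>

lemma bouligand_inter_subset_tangent_sub:
  assumes \<psi>: "C1_coordinates A \<psi>" "x \<in> fst \<psi>" and x: "x \<in> frontier S"
    and L: "subspace L" "snd \<psi> ` (fst \<psi> \<inter> frontier S) = snd \<psi> ` fst \<psi> \<inter> L"
    and v: "v \<in> bouligand_cone A g S x" "v \<in> bouligand_cone A g ((UNIV - S) \<union> frontier S) x"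
  shows "v \<in> tangent_space_sub A (frontier S) x"
proof -
  obtain \<kappa> where \<kappa>: "\<kappa> \<in> A" "x \<in> fst \<kappa>"
    by (rule atlas_cover)
  note ch = C1_coordinatesD(1) [OF \<psi>(1)]
  have vT: "v \<in> tangent_space A x"
    using v(1) unfolding bouligand_cone_def by blast
  define w where "w = frechet_derivative (transition \<kappa> \<psi>) (at (snd \<kappa> x)) (v \<kappa>)"
  define p where "p = snd \<psi> x"
  have vw: "v = coord_vector A \<psi> x w"
    unfolding w_def by (rule coord_vector_change [OF atlas \<psi> vT \<kappa>])
  have pL: "p \<in> L"
    using L(2) x \<psi>(2) unfolding p_def by blast
  have "p \<in> snd \<psi> ` fst \<psi>"
    using \<psi>(2) by (simp add: p_def)
  then obtain r where r: "r > 0" "ball p r \<subseteq> snd \<psi> ` fst \<psi>"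
    using open_contains_ball [THEN iffD1, OF is_chartD(2) [OF ch], rule_format, of p] by blast
  have frontier_L: "q \<in> L" if "q \<in> snd \<psi> ` fst \<psi>" "chart_inv \<psi> q \<in> frontier S" for q
  proof -
    have "snd \<psi> (chart_inv \<psi> q) \<in> snd \<psi> ` (fst \<psi> \<inter> frontier S)"
      using chart_inv_in [OF ch that(1)] that(2) by (intro imageI IntI)
    then show ?thesis
      unfolding chart_chart_inv [OF ch that(1)] L(2) by blast
  qed
  have L_frontier: "chart_inv \<psi> q \<in> frontier S" if "q \<in> snd \<psi> ` fst \<psi>" "q \<in> L" for q
  proof -
    have "q \<in> snd \<psi> ` (fst \<psi> \<inter> frontier S)"
      unfolding L(2) using that by blast
    then obtain y where y: "y \<in> fst \<psi>" "y \<in> frontier S" "q = snd \<psi> y"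
      by blast
    show ?thesis
      unfolding y(3) chart_inv_chart [OF ch y(1)] by (rule y(2))
  qed
  have "w \<in> L"
  proof (rule ccontr)
    assume "w \<notin> L"
    \<comment> \<open>The normal is the component of \<open>w\<close> orthogonal to
      \<open>L\<close>, so its inner product with \<open>w\<close> is its own squared norm.\<close>
    obtain y n where yn: "y \<in> span L" "\<And>u. u \<in> span L \<Longrightarrow> orthogonal n u" "w = y + n"
      using orthogonal_subspace_decomp_exists [of L w] by blast
    have n: "n \<bullet> u = 0" if "u \<in> L" for u
      using yn(2) [OF span_base [OF that]] by (simp add: orthogonal_def)
    have yL: "y \<in> L"
      using yn(1) L(1) by (metis span_eq_iff)
    have "n \<noteq> 0"
      using yL \<open>w \<notin> L\<close> yn(3) by auto
    then have wn: "w \<bullet> n > 0"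
      using n [OF yL] by (simp add: yn(3) inner_add_left inner_commute [of y n])
    \<comment> \<open>As \<open>p\<close> lies in \<open>L\<close>, the number
      \<open>n \<bullet> p\<close> is 0, and the strict inequality excludes every point of
      \<open>L\<close>.\<close>
    define H where "H = ball p r \<inter> {q. n \<bullet> q > n \<bullet> p}"
    have HD: "H \<subseteq> snd \<psi> ` fst \<psi>"
      using r(2) by (auto simp: H_def)
    define G where "G = chart_inv \<psi> ` H"
    have "connected H"
      unfolding H_def by (intro convex_connected convex_Int convex_ball convex_halfspace_gt)
    then have "connected G"
      unfolding G_def
      by (intro connected_continuous_image continuous_on_subset [OF is_chartD(5) [OF ch] HD])
    have "G \<inter> frontier S = {}"
    proof -
      have False if "q \<in> H" "chart_inv \<psi> q \<in> frontier S" for q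
      proof -
        have "q \<in> L"
          using frontier_L that HD by blast
        then show False
          using n [OF pL] n [of q] that(1) by (simp add: H_def)
      qed
      then show ?thesis
        unfolding G_def by blast
    qed
    have meets: "\<exists>y\<in>B. y \<in> G" if vB: "v \<in> bouligand_cone A g B x" for B
    proof -
      obtain z t where zt: "\<And>i::nat. z i \<in> B" "\<And>i. t i > (0::real)" "z \<longlonglongrightarrow> x"
        "(\<lambda>i. (snd \<psi> (z i) - snd \<psi> x) /\<^sub>R t i) \<longlonglongrightarrow> w"
        unfolding w_def using bouligand_in_coordinates [OF vB \<kappa> \<psi>] by blast
      obtain i where i: "z i \<in> fst \<psi>" "snd \<psi> (z i) \<in> ball (snd \<psi> x) r"
        "(snd \<psi> (z i) - snd \<psi> x) \<bullet> n > 0"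
        by (rule sequence_meets_half_ball [OF ch \<psi>(2) zt(3,2,4) wn r(1)])
      have "snd \<psi> (z i) \<in> H"
        using i(2,3) by (simp add: H_def p_def inner_diff_right inner_commute [of _ n])
      then have "chart_inv \<psi> (snd \<psi> (z i)) \<in> G"
        unfolding G_def by (rule imageI)
      then show ?thesis
        using zt(1) [of i] chart_inv_chart [OF ch i(1)] by auto
    qed
    have "G \<inter> S \<noteq> {}"
      using meets [OF v(1)] by blast
    \<comment> \<open>A point of \<open>G\<close> in \<open>(UNIV - S) \<union> frontier S\<close>
      cannot be in the frontier, which \<open>G\<close> misses; hence it is outside
      \<open>S\<close>. A connected set meeting both \<open>S\<close> and its complement would have
      to meet the frontier.\<close>
    moreover have "G - S \<noteq> {}"
      using meets [OF v(2)] \<open>G \<inter> frontier S = {}\<close> by blast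
    ultimately show False
      using connected_Int_frontier [OF \<open>connected G\<close>] \<open>G \<inter> frontier S = {}\<close> by blast
  qed
  \<comment> \<open>For times below \<open>\<delta>\<close> the line stays in the ball of radius
    \<open>r\<close>; the summand 1 takes care of \<open>w = 0\<close>.\<close>
  define \<delta> where "\<delta> = r / (norm w + 1)"
  have \<delta>: "\<delta> > 0"
    unfolding \<delta>_def using r(1) by (intro divide_pos_pos add_nonneg_pos) auto
  let ?I = "{-\<delta><..<\<delta>}"
  have line: "p + t *\<^sub>R w \<in> snd \<psi> ` fst \<psi>" if "t \<in> ?I" for t
  proof -
    have "\<bar>t\<bar> * norm w \<le> \<delta> * norm w"
      by (rule mult_right_mono) (use that in auto)
    also have "\<dots> < \<delta> * (norm w + 1)"
      using \<delta> by simp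
    also have "\<dots> = r"
      unfolding \<delta>_def using norm_ge_zero [of w] by (simp add: add_nonneg_eq_0_iff)
    finally have "p + t *\<^sub>R w \<in> ball p r"
      by (simp add: dist_norm)
    then show ?thesis
      using r(2) by blast
  qed
  have nb: "at t within ?I \<noteq> bot" if "t \<in> ?I" for t
    using at_within_open [OF that open_greaterThanLessThan] by simp
  have 0: "(0::real) \<in> ?I"
    using \<delta> by simp
  let ?c = "\<lambda>t. chart_inv \<psi> (p + t *\<^sub>R w)"
  have c0: "?c 0 = x"
    using chart_inv_chart [OF ch \<psi>(2)] by (simp add: p_def)
  have "?c ` ?I \<subseteq> frontier S"
  proof clarify
    fix t assume t: "t \<in> ?I"
    show "?c t \<in> frontier S"
      by (intro L_frontier [OF line [OF t]] subspace_add [OF L(1)] subspace_scale [OF L(1)] pL \<open>w \<in> L\<close>)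
  qed
  moreover have "C1_curve A ?I ?c"
    by (rule coord_line_C1 [OF \<psi>(1) line nb])
  moreover have "velocity A ?I ?c 0 = coord_vector A \<psi> (?c 0) w"
    by (rule coord_line_velocity [OF \<psi>(1) line nb 0])
  then have "velocity A ?I ?c 0 = v"
    unfolding c0 vw [symmetric] .
  ultimately show ?thesis
    unfolding tangent_space_sub_def using \<delta> c0 by blast
qed

end

theorem theorem3p6:
  fixes A :: "('m::{t2_space,second_countable_topology}, 'e::euclidean_space) chart set"
    and g :: "('m, 'e) metric"
    and S Shat :: "'m set"
  assumes "riemannian_manifold A g"
    and "prox_regular A g S"
    and "Ck_submanifold 2 A (frontier S)"
    and "Shat = (UNIV - S) \<union> frontier S"
  shows "closed Shat \<and>
    (\<forall>x\<in>frontier S. bouligand_cone A g S x \<inter> bouligand_cone A g Shat x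
                    = tangent_space_sub A (frontier S) x)"
proof -
  interpret riemannian A g
    by unfold_locales (rule assms(1))
  have S: "closed S"
    using assms(2) unfolding prox_regular_def by blast
  \<comment> \<open>The points of \<open>S\<close> outside its frontier are its interior points, so
    closedness becomes openness of the interior.\<close>
  have "Shat = - interior S"
    unfolding assms(4) frontier_def using interior_subset [of S] closure_subset [of S] by blast
  then have "closed Shat"
    by (simp add: closed_Compl)
  moreover have "bouligand_cone A g S x \<inter> bouligand_cone A g Shat x
      = tangent_space_sub A (frontier S) x" if x: "x \<in> frontier S" for x
  proof (intro subset_antisym subsetI IntI)
    fix v assume v: "v \<in> bouligand_cone A g S x \<inter> bouligand_cone A g Shat x"
    obtain \<psi> L where \<psi>: "is_chart \<psi>" "\<forall>\<kappa>\<in>A. Ck_compatible 2 \<psi> \<kappa>" "x \<in> fst \<psi>" "subspace L"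
      "snd \<psi> ` (fst \<psi> \<inter> frontier S) = snd \<psi> ` fst \<psi> \<inter> L"
      using assms(3) x unfolding Ck_submanifold_def by blast
    have "C1_coordinates A \<psi>"
      using \<psi>(1,2) Ck_compatible_Suc_imp [of 1 \<psi>] unfolding C1_coordinates_def Suc_1 by blast
    then show "v \<in> tangent_space_sub A (frontier S) x"
      by (rule bouligand_inter_subset_tangent_sub [OF _ \<psi>(3) x \<psi>(4,5)])
         (use v in \<open>simp_all add: assms(4)\<close>)
  next
    fix v assume v: "v \<in> tangent_space_sub A (frontier S) x"
    have xS: "x \<in> S"
      using frontier_subset_closed [OF S] x by blast
    then obtain \<epsilon> where "\<epsilon> > 0" "convex_set A g (riem_ball A g x \<epsilon>)"
      using assms(2) unfolding prox_regular_def prox_regular_at_def by blast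
    then have U: "convex_nbhd A g x (riem_ball A g x \<epsilon>)"
      unfolding convex_nbhd_def using in_interior_riem_ball by blast
    show "v \<in> bouligand_cone A g S x"
      by (rule tangent_sub_subset_bouligand [OF U frontier_subset_closed [OF S] v])
    show "v \<in> bouligand_cone A g Shat x"
      by (rule tangent_sub_subset_bouligand [OF U _ v]) (simp add: assms(4))
  qed
  ultimately show ?thesis
    by blast
qed

end
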